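(* Let $\mathcal{D}$ be an open disk centred at the origin with radius $r_0>0$, let $\mathcal{Z}$ be the zero process of the standard planar Gaussian analytic function $f(z)=\sum_{k\ge0}\frac{\xi_k}{\sqrt{k!}}z^k$ and $\mathcal{Z}_n$ the zero process of $f_n(z)=\sum_{k=0}^n\frac{\xi_k}{\sqrt{k!}}z^k$ (same coefficients $\xi_k$). With $\alpha_k(n)$ and $\alpha_k$ as defined in the context, for each $k\ge1$ we have $\alpha_k(n)\to\alpha_k$ in probability as $n\to\infty$. Hence there is a subsequence such that, almost surely, $\alpha_k(n)\to\alpha_k$ as $n\to\infty$ along this subsequence, simultaneously for all $k$.
   Context: $(\xi_k)_{k\ge0}$ are i.i.d. standard complex Gaussians. For a point process $\Pi$, $[\Pi]=\sum_{z\in\Pi}\delta_z$. $\varphi$ is a non-negative radial $C_c^\infty$ function on $\mathbb{C}$ supported on $\{r_0\le|z|\le3r_0\}$, with (as a function of $|z|$) $\varphi=1$ on $[\frac{3r_0}2,2r_0]$ and $\varphi(r_0+r)=1-\varphi(2r_0+2r)$ for $0\le r\le\frac12r_0$. $\widetilde\varphi$ is the radial function with $\widetilde\varphi=1$ for $r_0\le|z|\le\frac{3r_0}2$ and $\widetilde\varphi=\varphi$ otherwise. $\psi_L(z):=\psi(z/L)$. The functions $\widetilde\varphi,\varphi_{2^j}$ $(j\ge1)$ form a partition of unity on $\mathcal{D}^c$. For $k\ge1$: $S_k(n)=\sum_{\omega\in\mathcal{Z}_n\cap\mathcal{D}^c}\frac1{\omega^k}$ and $S_k=\int\frac{\widetilde\varphi(z)}{z^k}d[\mathcal{Z}](z)+\sum_{j=1}^\infty\int\frac{\varphi_{2^j}(z)}{z^k}d[\mathcal{Z}](z)$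 (a well-defined random variable with finite first moment); $S_k(\mathcal{D},n)=\sum_{z\in\mathcal{Z}_n\cap\mathcal{D}}\frac1{z^k}$ and $S_k(\mathcal{D})=\sum_{z\in\mathcal{Z}\cap\mathcal{D}}\frac1{z^k}$. Set $\alpha_k(n)=S_k(\mathcal{D},n)+S_k(n)=\sum_{z\in\mathcal{Z}_n}\frac1{z^k}$ and $\alpha_k=S_k(\mathcal{D})+S_k$. *)

theory Defs
  imports "HOL-Probability.Probability" "HOL-Complex_Analysis.Complex_Analysis"
begin

text \<open>The standard complex Gaussian has density \<open>exp (-|z|\<^sup>2) / \<pi>\<close>, so that \<open>E |\<xi>|\<^sup>2 = 1\<close>.\<close>

definition std_complex_normal_density :: "complex \<Rightarrow> real" where
  "std_complex_normal_density z = exp (- (cmod z)\<^sup>2) / pi"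

definition iid_std_complex_gaussian :: "'w measure \<Rightarrow> (nat \<Rightarrow> 'w \<Rightarrow> complex) \<Rightarrow> bool" where
  "iid_std_complex_gaussian M \<xi> \<longleftrightarrow>
     prob_space.indep_vars M (\<lambda>_. borel) \<xi> UNIV \<and>
     (\<forall>j. distributed M lborel (\<xi> j) (\<lambda>z. ennreal (std_complex_normal_density z)))"

text \<open>Both functions take the coefficients of one realisation. Almost surely the series defines an
  entire function.\<close>

definition gaf :: "(nat \<Rightarrow> complex) \<Rightarrow> complex \<Rightarrow> complex" where
  "gaf c z = (\<Sum>j. c j / of_real (sqrt (fact j)) * z ^ j)"

definition gaf_trunc :: "nat \<Rightarrow> (nat \<Rightarrow> complex) \<Rightarrow> complex \<Rightarrow> complex" where
  "gaf_trunc n c z = (\<Sum>j\<le>n. c j / of_real (sqrt (fact j)) * z ^ j)"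

text \<open>Zeros are counted with multiplicity (those of the Gaussian analytic function and of its
  truncations are almost surely simple). \<open>zero_measure g\<close> is the sum of the unit masses at the
  zeros of \<open>g\<close>, written \<open>[\<Pi>]\<close> for a point process \<open>\<Pi>\<close>.\<close>

definition zero_measure :: "(complex \<Rightarrow> complex) \<Rightarrow> complex measure" where
  "zero_measure g = point_measure {z. g z = 0} (\<lambda>z. ennreal (of_int (zorder g z)))"

text \<open>The sum of \<open>1 / z ^ k\<close> over the zeros of \<open>g\<close> in \<open>A\<close>. It is only used where there are
  almost surely finitely many such zeros.\<close>

definition zero_power_sum :: "(complex \<Rightarrow> complex) \<Rightarrow> complex set \<Rightarrow> nat \<Rightarrow> complex" where
  "zero_power_sum g A k = (\<Sum>z \<in> {z \<in> A. g z = 0}. of_int (zorder g z) * (1 / z ^ k))"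

primrec C_k :: "nat \<Rightarrow> ('a::real_normed_vector \<Rightarrow> 'b::real_normed_vector) \<Rightarrow> bool" where
  "C_k 0 f \<longleftrightarrow> continuous_on UNIV f"
| "C_k (Suc m) f \<longleftrightarrow>
     (\<forall>x. f differentiable (at x)) \<and> (\<forall>v. C_k m (\<lambda>x. frechet_derivative f (at x) v))"

definition C_infinity :: "('a::real_normed_vector \<Rightarrow> 'b::real_normed_vector) \<Rightarrow> bool" where
  "C_infinity f \<longleftrightarrow> (\<forall>m. C_k m f)"

text \<open>In the last two conditions \<open>\<phi>\<close> is viewed as a function of \<open>|z|\<close>, by evaluating it on the
  positive real axis. Smoothness is in the real sense, on the plane.\<close>

definition cutoff :: "real \<Rightarrow> (complex \<Rightarrow> real) \<Rightarrow> bool" where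
  "cutoff r0 \<phi> \<longleftrightarrow>
     C_infinity \<phi> \<and>
     (\<forall>z. 0 \<le> \<phi> z) \<and>
     (\<forall>z w. cmod z = cmod w \<longrightarrow> \<phi> z = \<phi> w) \<and>
     (\<forall>z. \<phi> z \<noteq> 0 \<longrightarrow> r0 \<le> cmod z \<and> cmod z \<le> 3 * r0) \<and>
     (\<forall>r. 3 * r0 / 2 \<le> r \<and> r \<le> 2 * r0 \<longrightarrow> \<phi> (of_real r) = 1) \<and>
     (\<forall>r. 0 \<le> r \<and> r \<le> r0 / 2 \<longrightarrow> \<phi> (of_real (r0 + r)) = 1 - \<phi> (of_real (2 * r0 + 2 * r)))"

definition cutoff_tilde :: "real \<Rightarrow> (complex \<Rightarrow> real) \<Rightarrow> complex \<Rightarrow> real" where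
  "cutoff_tilde r0 \<phi> z = (if r0 \<le> cmod z \<and> cmod z \<le> 3 * r0 / 2 then 1 else \<phi> z)"

definition rescale :: "real \<Rightarrow> (complex \<Rightarrow> real) \<Rightarrow> complex \<Rightarrow> real" where
  "rescale L \<psi> z = \<psi> (z / of_real L)"

text \<open>\<open>S_outer\<close> is the regularised sum over the zeros outside the disk; the summation index
  \<open>j \<ge> 1\<close> appears as \<open>Suc j\<close>. The series converges almost surely.\<close>

definition S_outer :: "real \<Rightarrow> (complex \<Rightarrow> real) \<Rightarrow> nat \<Rightarrow> (complex \<Rightarrow> complex) \<Rightarrow> complex" where
  "S_outer r0 \<phi> k g =
     (\<integral>z. of_real (cutoff_tilde r0 \<phi> z) / z ^ k \<partial>zero_measure g) +
     (\<Sum>j. \<integral>z. of_real (rescale (2 ^ Suc j) \<phi> z) / z ^ k \<partial>zero_measure g)"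

definition alpha_limit :: "real \<Rightarrow> (complex \<Rightarrow> real) \<Rightarrow> nat \<Rightarrow> (nat \<Rightarrow> complex) \<Rightarrow> complex" where
  "alpha_limit r0 \<phi> k c = zero_power_sum (gaf c) (ball 0 r0) k + S_outer r0 \<phi> k (gaf c)"

definition alpha_trunc :: "real \<Rightarrow> nat \<Rightarrow> nat \<Rightarrow> (nat \<Rightarrow> complex) \<Rightarrow> complex" where
  "alpha_trunc r0 k n c =
     zero_power_sum (gaf_trunc n c) (ball 0 r0) k + zero_power_sum (gaf_trunc n c) (- ball 0 r0) k"

text \<open>The limit and the terms are required to be random variables, so that the events below are
  measurable. Quantities that are defined only almost surely, such as those built from \<open>gaf\<close>, are
  random variables on the completion of the underlying probability space.\<close>

definition tendsto_in_probability ::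
    "'w measure \<Rightarrow> (nat \<Rightarrow> 'w \<Rightarrow> 'a::metric_space) \<Rightarrow> ('w \<Rightarrow> 'a) \<Rightarrow> bool" where
  "tendsto_in_probability M X Y \<longleftrightarrow>
     (\<forall>n. X n \<in> borel_measurable M) \<and> Y \<in> borel_measurable M \<and>
     (\<forall>\<epsilon>>0. (\<lambda>n. measure M {\<omega> \<in> space M. \<epsilon> < dist (X n \<omega>) (Y \<omega>)}) \<longlonglongrightarrow> 0)"

end

(* Let F = sum_j c_j / sqrt(j!) z^j as a formal power series.
   Expanding 1 / (z - a) over the roots of the polynomial f_n, the coefficient of z^(k-1) in -f_n'/f_n
   is the power sum alpha_k(n); it involves only c_0, ..., c_k, so alpha_k(n) does not depend on n once
   n >= k. Hence everything reduces to alpha_k = [z^(k-1)] (-F'/F) almost surely, and s = id is an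
   admissible subsequence.

   The cut-offs telescope: the J-th partial sum of alpha_k is the sum of q(|a| / 2^J) / a^k over the zeros
   a of f, where q = 1 on [0, 2 r0], q = phi on [2 r0, 3 r0] and q = 0 beyond. Jensen's formula for the
   k-th Fourier coefficient reads
     sum_{|a| < r} (1 / a^k - conj(a)^k / r^(2k))
       = [z^(k-1)] (-F'/F) + k / (pi r^k) * integral_0^(2 pi) log|f(r e^(it))| e^(-ikt) dt,
   and averaging the kernel (1 - (|a| / r)^(2k))_+ over r = 2^J s with a suitable weight g(s) on
   [2 r0, 3 r0] produces q(|a| / 2^J). Subtracting from log|f| a radial function m(|z|) does not change the
   integral, so the error is at most a constant times 2^(-Jk) times the mean of |log|f| - m| over the
   annulus 2 r0 <= |z| / 2^J <= 3 r0. With m the logarithm of the maximal term of sum_j r^j / sqrt(j!), the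
   expectation of |log|f(z)| - m(|z|)| is O(log|z|): the positive part is controlled by E|f(z)|, and the
   negative part by conditioning on all coefficients but the one of the maximal term. The errors are
   therefore summable in J, and tend to zero almost surely. *)

theory Submission
  imports Defs "HOL-Computational_Algebra.Fundamental_Theorem_Algebra"
begin

section \<open>Logarithmic derivatives of formal power series\<close>

text \<open>The minus sign makes a root \<open>a\<close> count positively: - 1 / (z - a) is the
  generating function of the numbers 1 / a^(n+1), so that coefficient k - 1 collects the k-th
  inverse powers.\<close>

definition neg_log_deriv :: "complex fps \<Rightarrow> complex fps" where
  "neg_log_deriv F = - (fps_deriv F * inverse F)"

lemma neg_log_deriv_mult:
  assumes "fps_nth F 0 \<noteq> 0" "fps_nth G 0 \<noteq> 0"
  shows "neg_log_deriv (F * G) = neg_log_deriv F + neg_log_deriv G"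
proof -
  have "F * inverse F = 1" "G * inverse G = 1"
    using assms by (simp_all add: inverse_mult_eq_1')
  then have "fps_deriv F * inverse F * (G * inverse G) + fps_deriv G * inverse G * (F * inverse F)
      = fps_deriv F * inverse F + fps_deriv G * inverse G"
    by simp
  then show ?thesis
    by (simp add: neg_log_deriv_def fps_inverse_mult algebra_simps)
qed

lemma neg_log_deriv_const [simp]: "neg_log_deriv (fps_const c) = 0"
  by (simp add: neg_log_deriv_def)

lemma neg_log_deriv_1 [simp]: "neg_log_deriv 1 = 0"
  by (simp add: neg_log_deriv_def)

lemma neg_log_deriv_power:
  assumes "fps_nth F 0 \<noteq> 0"
  shows "neg_log_deriv (F ^ n) = of_nat n * neg_log_deriv F"
  using assms by (induction n) (simp_all add: neg_log_deriv_mult algebra_simps)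

lemma neg_log_deriv_prod:
  assumes "finite S" "\<And>a. a \<in> S \<Longrightarrow> fps_nth (F a) 0 \<noteq> 0"
  shows "neg_log_deriv (\<Prod>a\<in>S. F a) = (\<Sum>a\<in>S. neg_log_deriv (F a))"
  using assms
proof (induction S)
  case (insert a S)
  have "fps_nth (\<Prod>a\<in>S. F a) 0 = (\<Prod>a\<in>S. fps_nth (F a) 0)"
    by (induction S rule: infinite_finite_induct) simp_all
  then show ?case
    using insert by (simp add: neg_log_deriv_mult)
qed simp

text \<open>Geometric series for b / (c - b z). It is used with c = -a, b = -1 for the factor z - a,
  and with c = r^2, b = \<open>cnj a\<close> for its reflection in the circle of radius r.\<close>

lemma neg_log_deriv_linear:
  fixes b c :: complex
  assumes "c \<noteq> 0"
  shows "fps_nth (neg_log_deriv (fps_const c - fps_const b * fps_X)) n = (b / c) ^ Suc n"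
proof -
  let ?F = "fps_const c - fps_const b * fps_X"
  let ?G = "Abs_fps (\<lambda>n. (b / c) ^ Suc n)"
  have "?G * ?F = fps_const b"
  proof (rule fps_ext)
    fix n
    show "fps_nth (?G * ?F) n = fps_nth (fps_const b) n"
    proof (cases n)
      case (Suc m)
      then have "fps_nth (?G * ?F) n = (b / c) ^ Suc (Suc m) * c - (b / c) ^ Suc m * b"
        by (simp only: right_diff_distrib mult.assoc[symmetric]) simp
      then show ?thesis
        using assms Suc by simp
    qed (use assms in simp)
  qed
  moreover have "?F * inverse ?F = 1"
    using assms by (intro inverse_mult_eq_1') simp
  moreover have "fps_deriv ?F = - fps_const b"
    by simp
  moreover have "G = - (D * I)" if "G * F = B" "F * I = 1" "D = - B" for G F B I D :: "complex fps"
  proof -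
    have "G = G * (F * I)"
      using that(2) by simp
    also have "\<dots> = B * I"
      using that(1) by (simp add: mult.assoc[symmetric])
    finally show ?thesis
      using that(3) by simp
  qed
  ultimately have "?G = neg_log_deriv ?F"
    unfolding neg_log_deriv_def by blast
  then have "fps_nth (neg_log_deriv ?F) n = fps_nth ?G n"
    by (simp only:)
  then show ?thesis
    by (simp only: fps_nth_Abs_fps)
qed

section \<open>Dependence on finitely many coefficients, and measurability\<close>

lemma fps_inverse_Suc_nth:
  fixes F :: "complex fps"
  assumes "fps_nth F 0 \<noteq> 0"
  shows "fps_nth (inverse F) (Suc n) =
    - (\<Sum>i\<le>n. fps_nth F (Suc n - i) * fps_nth (inverse F) i) / fps_nth F 0"
proof -
  have "fps_nth (inverse F * F) (Suc n) = 0"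
    using assms by (simp add: inverse_mult_eq_1)
  then have "(\<Sum>i\<le>n. fps_nth (inverse F) i * fps_nth F (Suc n - i)) + fps_nth (inverse F) (Suc n) * fps_nth F 0 = 0"
    by (simp add: fps_mult_nth atLeast0AtMost)
  then show ?thesis
    using assms by (simp add: field_simps eq_neg_iff_add_eq_0 add.commute)
qed

lemma fps_inverse_nth_cong:
  fixes F G :: "complex fps"
  assumes "fps_nth F 0 \<noteq> 0" "\<And>i. i \<le> n \<Longrightarrow> fps_nth F i = fps_nth G i"
  shows "fps_nth (inverse F) n = fps_nth (inverse G) n"
  using assms(2)
proof (induction n rule: less_induct)
  case (less n)
  have "fps_nth G 0 \<noteq> 0"
    using assms(1) less.prems by simp
  show ?case
  proof (cases n)
    case 0
    then show ?thesis
      using less.prems by simp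
  next
    case (Suc m)
    have "(\<Sum>i\<le>m. fps_nth F (Suc m - i) * fps_nth (inverse F) i)
        = (\<Sum>i\<le>m. fps_nth G (Suc m - i) * fps_nth (inverse G) i)"
      using less Suc by (intro sum.cong refl arg_cong2[where f="(*)"]) auto
    then show ?thesis
      using Suc less.prems assms(1) \<open>fps_nth G 0 \<noteq> 0\<close> by (simp add: fps_inverse_Suc_nth)
  qed
qed

text \<open>This locality is what makes the power sums over the zeros of the truncations
  stationary.\<close>

lemma neg_log_deriv_nth_cong:
  assumes "fps_nth F 0 \<noteq> 0" "\<And>i. i \<le> Suc n \<Longrightarrow> fps_nth F i = fps_nth G i"
  shows "fps_nth (neg_log_deriv F) n = fps_nth (neg_log_deriv G) n"
  unfolding neg_log_deriv_def fps_neg_nth fps_mult_nth fps_deriv_nth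
  using assms by (intro arg_cong[where f=uminus] sum.cong refl arg_cong2[where f="(*)"]
      fps_inverse_nth_cong) auto

lemma measurable_fps_inverse_nth:
  fixes F :: "'w \<Rightarrow> complex fps"
  assumes "\<And>\<omega>. fps_nth (F \<omega>) 0 \<noteq> 0" and [measurable]: "\<And>i. (\<lambda>\<omega>. fps_nth (F \<omega>) i) \<in> borel_measurable M"
  shows "(\<lambda>\<omega>. fps_nth (inverse (F \<omega>)) n) \<in> borel_measurable M"
proof (induction n rule: less_induct)
  case (less n)
  show ?case
  proof (cases n)
    case (Suc m)
    have [measurable]: "(\<lambda>\<omega>. fps_nth (inverse (F \<omega>)) i) \<in> borel_measurable M" if "i \<in> {..m}" for i
      using that less Suc by simp
    show ?thesis
      unfolding Suc fps_inverse_Suc_nth[OF assms(1)] by measurable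
  qed simp
qed

lemma measurable_neg_log_deriv_nth:
  fixes F :: "'w \<Rightarrow> complex fps"
  assumes "\<And>\<omega>. fps_nth (F \<omega>) 0 \<noteq> 0" and [measurable]: "\<And>i. (\<lambda>\<omega>. fps_nth (F \<omega>) i) \<in> borel_measurable M"
  shows "(\<lambda>\<omega>. fps_nth (neg_log_deriv (F \<omega>)) n) \<in> borel_measurable M"
proof -
  note [measurable] = measurable_fps_inverse_nth[OF assms]
  show ?thesis
    unfolding neg_log_deriv_def fps_neg_nth fps_mult_nth fps_deriv_nth by measurable
qed

section \<open>Fourier coefficients of the logarithm of the modulus\<close>

text \<open>Both are contour integrals around the circle in its angular parameter: the first is
  Cauchy's formula for the k-th derivative at 0, the second Cauchy's theorem for H(u) u^(k-1), which
  is holomorphic because k >= 1.\<close>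

lemma
  assumes H: "H holomorphic_on ball 0 \<rho>" and r: "0 < r" "r < \<rho>" and k: "1 \<le> k"
  shows has_integral_circle_fourier:
      "((\<lambda>t. H (of_real r * cis t) * cis (- (real k * t))) has_integral
         2 * pi * of_real r ^ k * fps_nth (fps_expansion H 0) k) {0..2*pi}" (is ?T1)
    and has_integral_circle_fourier_neg:
      "((\<lambda>t. H (of_real r * cis t) * cis (real k * t)) has_integral 0) {0..2*pi}" (is ?T2)
proof -
  have sub: "ball (0::complex) r \<subseteq> ball 0 \<rho>" "cball (0::complex) r \<subseteq> ball 0 \<rho>"
    using r by auto
  have cis_k: "cis (real k * t) = cis t ^ k" for t
    by (rule Complex.DeMoivre[symmetric])
  have "((\<lambda>u. H u / (u - 0) ^ Suc k) has_contour_integral (2 * pi * \<i>) / fact k * (deriv ^^ k) H 0)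
      (circlepath 0 r)"
    using r by (intro Cauchy_has_contour_integral_higher_derivative_circlepath
        holomorphic_on_imp_continuous_on holomorphic_on_subset[OF H] sub) auto
  then have "((\<lambda>t. H (of_real r * cis t) / (of_real r * cis t) ^ Suc k * r * \<i> * cis t) has_integral
      (2 * pi * \<i>) / fact k * (deriv ^^ k) H 0) {0..2*pi}"
    by (simp add: circlepath_def has_contour_integral_part_circlepath_iff)
  from has_integral_mult_right[OF this, of "of_real r ^ k / \<i>"]
  have "((\<lambda>t. of_real r ^ k / \<i> * (H (of_real r * cis t) / (of_real r * cis t) ^ Suc k * r * \<i> * cis t))
      has_integral 2 * pi * of_real r ^ k * fps_nth (fps_expansion H 0) k) {0..2*pi}"
    by (simp add: fps_expansion_def mult_ac)
  moreover have "of_real r ^ k / \<i> * (H (of_real r * cis t) / (of_real r * cis t) ^ Suc k * r * \<i> * cis t)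
     = H (of_real r * cis t) * cis (- (real k * t))" for t
  proof -
    have "cis (- (real k * t)) = 1 / cis t ^ k"
      by (metis cis_inverse cis_k inverse_eq_divide)
    then show ?thesis
      using r by (simp add: power_mult_distrib field_simps)
  qed
  ultimately show ?T1
    by (simp only:)
  have "((\<lambda>u. H u * u ^ (k - 1)) has_contour_integral 0) (circlepath 0 r)"
    using r by (intro Cauchy_theorem_disc_simple[of _ 0 \<rho>] holomorphic_intros H) auto
  then have "((\<lambda>t. H (of_real r * cis t) * (of_real r * cis t) ^ (k - 1) * r * \<i> * cis t) has_integral 0) {0..2*pi}"
    by (simp add: circlepath_def has_contour_integral_part_circlepath_iff)
  from has_integral_mult_right[OF this, of "1 / (\<i> * of_real r ^ k)"]
  have "((\<lambda>t. 1 / (\<i> * of_real r ^ k) * (H (of_real r * cis t) * (of_real r * cis t) ^ (k - 1) * r * \<i> * cis t))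
     has_integral 0) {0..2*pi}"
    by simp
  moreover have "1 / (\<i> * of_real r ^ k) * (H (of_real r * cis t) * (of_real r * cis t) ^ (k - 1) * r * \<i> * cis t)
     = H (of_real r * cis t) * cis (real k * t)" for t
  proof -
    obtain j where "k = Suc j"
      using k by (cases k) auto
    then show ?thesis
      using r by (subst cis_k) (simp add: power_mult_distrib field_simps)
  qed
  ultimately show ?T2
    by (simp only:)
qed

text \<open>With h = exp H, the logarithm of |h| is Re H = (H + cnj H) / 2. The conjugate half
  contributes nothing, since the opposite Fourier coefficient of H vanishes, and F' = H' F turns the
  k-th coefficient of H into one of -F'/F at the cost of a factor -k.\<close>

lemma has_integral_circle_log_zero_free:
  assumes h: "h holomorphic_on ball 0 \<rho>" "\<And>z. z \<in> ball 0 \<rho> \<Longrightarrow> h z \<noteq> 0"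
    and r: "0 < r" "r < \<rho>" and k: "1 \<le> k" and F: "h has_fps_expansion F"
  shows "((\<lambda>t. of_real (ln (cmod (h (of_real r * cis t)))) * cis (- (real k * t))) has_integral
      - (of_real (pi * r ^ k / k) * fps_nth (neg_log_deriv F) (k - 1))) {0..2*pi}"
proof -
  have "contractible (ball (0::complex) \<rho>)"
    by (simp add: convex_imp_contractible)
  then obtain H where H: "H holomorphic_on ball 0 \<rho>" "\<And>z. z \<in> ball 0 \<rho> \<Longrightarrow> h z = exp (H z)"
    using contractible_imp_holomorphic_log[OF h(1)] h(2) by blast
  define G where "G = fps_expansion H 0"
  have G: "H has_fps_expansion G"
    unfolding G_def using H(1) r by (intro has_fps_expansion_fps_expansion[of "ball 0 \<rho>"]) auto
  have ev: "\<forall>\<^sub>F z in nhds 0. z \<in> ball 0 \<rho>"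
    using r by (intro eventually_nhds_in_open) auto
  have "deriv h has_fps_expansion fps_deriv F"
    by (intro has_fps_expansion_deriv F)
  moreover have "\<forall>\<^sub>F z in nhds 0. deriv h z = deriv H z * h z"
    using ev
  proof eventually_elim
    case (elim z)
    have "deriv h z = deriv (\<lambda>z. exp (H z)) z"
      using elim H(2) by (intro deriv_cong_ev eventually_mono[OF eventually_nhds_in_open[of "ball 0 \<rho>" z]]) auto
    also have "\<dots> = exp (H z) * deriv H z"
      using elim H(1) by (intro DERIV_imp_deriv derivative_eq_intros) (auto intro: holomorphic_derivI)
    finally show ?case
      using elim H(2) by simp
  qed
  ultimately have "(\<lambda>z. deriv H z * h z) has_fps_expansion fps_deriv F"
    using has_fps_expansion_cong by fastforce
  moreover have "(\<lambda>z. deriv H z * h z) has_fps_expansion fps_deriv G * F"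
    by (intro has_fps_expansion_mult has_fps_expansion_deriv F G)
  ultimately have "fps_deriv F = fps_deriv G * F"
    by (rule fps_expansion_unique_complex)
  moreover have "fps_nth F 0 \<noteq> 0"
    using has_fps_expansion_imp_0_eq_fps_nth_0[OF F] h(2)[of 0] r by auto
  ultimately have "neg_log_deriv F = - fps_deriv G"
    by (simp add: neg_log_deriv_def mult.assoc inverse_mult_eq_1')
  then have coeff: "fps_nth (neg_log_deriv F) (k - 1) = - of_nat k * fps_nth G k"
    using k by simp
  have "((\<lambda>t. (H (of_real r * cis t) * cis (- (real k * t)) +
        cnj (H (of_real r * cis t) * cis (real k * t))) / 2) has_integral
      (2 * pi * of_real r ^ k * fps_nth G k + cnj 0) / 2) {0..2*pi}"
    unfolding G_def
    by (intro has_integral_divide has_integral_add has_integral_circle_fourier[OF H(1) r k]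
        has_integral_linear[OF has_integral_circle_fourier_neg[OF H(1) r k] bounded_linear_cnj, unfolded o_def])
  moreover have "(H (of_real r * cis t) * cis (- (real k * t)) +
        cnj (H (of_real r * cis t) * cis (real k * t))) / 2
      = of_real (ln (cmod (h (of_real r * cis t)))) * cis (- (real k * t))" for t
  proof -
    have "of_real r * cis t \<in> ball 0 \<rho>"
      using r by (simp add: norm_mult)
    then show ?thesis
      by (simp add: H(2) cis_cnj complex_add_cnj flip: distrib_right)
  qed
  moreover have "(2 * pi * of_real r ^ k * fps_nth G k + cnj 0) / 2 =
      - (of_real (pi * r ^ k / k) * fps_nth (neg_log_deriv F) (k - 1))"
    using k by (simp add: coeff del: One_nat_def)
  ultimately show ?thesis
    by (simp only:)
qed

section \<open>Zeros of entire functions and Jensen's formula\<close>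

lemma zorder_nonneg_entire:
  assumes "f holomorphic_on UNIV" "f w \<noteq> 0"
  shows "0 \<le> zorder f z"
proof -
  have "\<forall>\<^sub>F u in at z. f u \<noteq> 0"
    using non_zero_neighbour_alt[of f UNIV z w] assms by (simp add: connected_UNIV)
  then show ?thesis
    using assms(1) by (intro zorder_ge_0 eventually_frequently) (auto intro: holomorphic_on_imp_analytic_at)
qed

lemma finite_zeros_entire:
  fixes f :: "complex \<Rightarrow> complex"
  assumes "f holomorphic_on UNIV" "f w \<noteq> 0" "compact K"
  shows "finite {z \<in> K. f z = 0}"
proof -
  have "\<not> f constant_on UNIV" if "f z = 0" for z
    using assms(2) that unfolding constant_on_def by (metis UNIV_I)
  then show ?thesis
    using holomorphic_compact_finite_zeros[of f UNIV K] assms by (cases "\<exists>z. f z = 0") auto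
qed

text \<open>The zero-free case of the Fourier formula asks for holomorphy past the circle, so the
  factorisation must hold on a larger disk. Such a disk exists because no zero lies on the circle
  and the zeros are isolated.\<close>

lemma entire_factor_zeros:
  assumes f: "f holomorphic_on UNIV" "f w \<noteq> 0"
    and sphere: "\<And>z. cmod z = r \<Longrightarrow> f z \<noteq> 0"
  defines "S \<equiv> {z \<in> ball 0 r. f z = 0}"
  shows "\<exists>\<rho>>r. \<exists>h. h holomorphic_on ball 0 \<rho> \<and> (\<forall>z\<in>ball 0 \<rho>. h z \<noteq> 0) \<and>
    (\<forall>z\<in>ball 0 \<rho>. f z = h z * (\<Prod>a\<in>S. (z - a) ^ nat (zorder f a)))"
proof -
  have finS: "finite S"
    unfolding S_def using finite_zeros_entire[OF f compact_cball[of 0 r]] by (rule rev_finite_subset) auto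
  have finC: "finite {z \<in> cball 0 (r + 1). f z = 0}"
    by (rule finite_zeros_entire[OF f compact_cball])
  \<comment> \<open>The modulus of the nearest zero beyond the circle, capped by r + 1; the cap also
    keeps the set non-empty.\<close>
  define \<rho> where "\<rho> = Min (insert (r + 1) (cmod ` {z \<in> cball 0 (r + 1). f z = 0 \<and> r < cmod z}))"
  have fin': "finite (insert (r + 1) (cmod ` {z \<in> cball 0 (r + 1). f z = 0 \<and> r < cmod z}))"
    by (intro finite.insertI finite_imageI rev_finite_subset[OF finC]) auto
  then have \<rho>: "r < \<rho>" "\<rho> \<le> r + 1"
    unfolding \<rho>_def by (auto intro: Min_le)
  have in_S: "z \<in> S" if "z \<in> ball 0 \<rho>" "f z = 0" for z
  proof (rule ccontr)
    assume "z \<notin> S"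
    then have "r < cmod z"
      using that sphere[of z] by (force simp: S_def)
    then have "\<rho> \<le> cmod z"
      unfolding \<rho>_def using that \<rho> by (intro Min_le fin') auto
    then show False
      using that by simp
  qed
  let ?P = "\<lambda>z. \<Prod>a\<in>S. (z - a) ^ nat (zorder f a)"
  have ev: "\<forall>\<^sub>F u in at z. f u \<noteq> 0" for z
    using non_zero_neighbour_alt[of f UNIV z w] f by (simp add: connected_UNIV)
  have ana: "f analytic_on {z}" for z
    using f(1) by (auto intro: holomorphic_on_imp_analytic_at)
  have zpos: "zorder f a > 0" if "a \<in> S" for a
    using zorder_pos_iff'[OF ana eventually_frequently[OF _ ev]] that by (simp add: S_def)
  have "\<exists>h. h holomorphic_on ball 0 \<rho> \<and> (\<forall>z\<in>ball 0 \<rho>. h z \<noteq> 0) \<and> (\<forall>z\<in>ball 0 \<rho>. f z = h z * ?P z)"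
  proof (rule holomorphic_zorder_factorization[of f "ball 0 \<rho>" ?P])
    show "f holomorphic_on ball 0 \<rho>"
      using f(1) by (rule holomorphic_on_subset) simp
    show "?P holomorphic_on ball 0 \<rho>"
      by (intro holomorphic_intros)
    fix z :: complex assume z: "z \<in> ball 0 \<rho>"
    show Pz: "?P z = 0 \<longleftrightarrow> f z = 0"
      using finS in_S[OF z] zpos by (auto simp: S_def)
    show "zorder ?P z = zorder f z"
    proof (cases "z \<in> S")
      case True
      show ?thesis
      proof (rule zorder_eqI[of UNIV _ "\<lambda>w. \<Prod>a\<in>S - {z}. (w - a) ^ nat (zorder f a)"])
        show "(\<lambda>w. \<Prod>a\<in>S - {z}. (w - a) ^ nat (zorder f a)) holomorphic_on UNIV"
          by (intro holomorphic_intros)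
        show "(\<Prod>a\<in>S - {z}. (z - a) ^ nat (zorder f a)) \<noteq> 0"
          using finS by simp
        fix w
        have "(w - z) powi zorder f z = (w - z) ^ nat (zorder f z)"
          using zpos[OF True] by (simp add: power_int_def)
        then show "?P w = (\<Prod>a\<in>S - {z}. (w - a) ^ nat (zorder f a)) * (w - z) powi zorder f z"
          using finS True by (simp add: prod.remove[of S z] mult.commute)
      qed auto
    next
      case False
      then have "f z \<noteq> 0"
        using in_S z by blast
      then show ?thesis
        using Pz ana by (simp add: zorder_eq_0I analytic_intros)
    qed
  qed auto
  then show ?thesis
    using \<rho> by blast
qed

text \<open>Fourier form of Jensen's formula. The factorisation splits ln |f| into a zero-free part
  and the logarithms of |z - a|. The terms 1 / a^k come from comparing -F'/F with the logarithmic
  derivative of the zero-free factor, the conjugate powers from the reflected zeros.\<close>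

lemma has_integral_circle_log:
  assumes f: "f holomorphic_on UNIV" "f 0 \<noteq> 0" "f has_fps_expansion F"
    and r: "0 < r" "\<And>z. cmod z = r \<Longrightarrow> f z \<noteq> 0" and k: "1 \<le> k"
  defines "S \<equiv> {z \<in> ball 0 r. f z = 0}"
  shows "((\<lambda>t. of_real (ln (cmod (f (of_real r * cis t)))) * cis (- (real k * t))) has_integral
      of_real (pi * r ^ k / k) *
        ((\<Sum>a\<in>S. of_int (zorder f a) * (1 / a ^ k - cnj a ^ k / of_real r ^ (2 * k)))
          - fps_nth (neg_log_deriv F) (k - 1))) {0..2*pi}"
proof -
  obtain \<rho> h where \<rho>: "r < \<rho>" and h: "h holomorphic_on ball 0 \<rho>" "\<And>z. z \<in> ball 0 \<rho> \<Longrightarrow> h z \<noteq> 0"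
    and fh: "\<And>z. z \<in> ball 0 \<rho> \<Longrightarrow> f z = h z * (\<Prod>a\<in>S. (z - a) ^ nat (zorder f a))"
    using entire_factor_zeros[of f 0 r, OF f(1,2) r(2)] unfolding S_def by blast
  have finS: "finite S"
    unfolding S_def using finite_zeros_entire[OF f(1,2) compact_cball[of 0 r]]
    by (rule rev_finite_subset) auto
  have m: "zorder f a = int (nat (zorder f a))" for a
    using zorder_nonneg_entire[OF f(1,2)] by simp
  have S: "a \<noteq> 0" "cmod a < r" if "a \<in> S" for a
    using that f(2) by (auto simp: S_def)
  let ?c = "of_real (pi * r ^ k / k) :: complex"
  define H where "H = fps_expansion h 0"
  have H: "h has_fps_expansion H"
    unfolding H_def using h(1) r \<rho> by (intro has_fps_expansion_fps_expansion[of "ball 0 \<rho>"]) auto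
  \<comment> \<open>\<open>?X a\<close> is the series of z - a, put in the shape c - b z of
    \<open>neg_log_deriv_linear\<close>.\<close>
  let ?X = "\<lambda>a. fps_const (-a) - fps_const (-1) * fps_X"
  have "(\<lambda>z. h z * (\<Prod>a\<in>S. (- a - (-1) * z) ^ nat (zorder f a))) has_fps_expansion
      H * (\<Prod>a\<in>S. ?X a ^ nat (zorder f a))"
    by (intro fps_expansion_intros H)
  moreover have "\<forall>\<^sub>F z in nhds 0. h z * (\<Prod>a\<in>S. (- a - (-1) * z) ^ nat (zorder f a)) = f z"
    using eventually_nhds_in_open[of "ball 0 \<rho>" 0] r \<rho> by (auto simp: fh elim: eventually_mono)
  ultimately have "f has_fps_expansion H * (\<Prod>a\<in>S. ?X a ^ nat (zorder f a))"
    using has_fps_expansion_cong by fastforce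
  then have F: "F = H * (\<Prod>a\<in>S. ?X a ^ nat (zorder f a))"
    using f(3) by (rule fps_expansion_unique_complex[rotated])
  have F0: "fps_nth F 0 \<noteq> 0"
    using has_fps_expansion_imp_0_eq_fps_nth_0[OF f(3)] f(2) by simp
  have "neg_log_deriv F = neg_log_deriv H + (\<Sum>a\<in>S. of_nat (nat (zorder f a)) * neg_log_deriv (?X a))"
    using F0 finS S unfolding F
    by (subst neg_log_deriv_mult) (auto simp: neg_log_deriv_prod neg_log_deriv_power)
  then have "fps_nth (neg_log_deriv F) (k - 1) = fps_nth (neg_log_deriv H) (k - 1) +
      (\<Sum>a\<in>S. of_nat (nat (zorder f a)) * fps_nth (neg_log_deriv (?X a)) (k - 1))"
    by (simp add: fps_sum_nth fps_of_nat[symmetric])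
  also have "\<dots> = fps_nth (neg_log_deriv H) (k - 1) + (\<Sum>a\<in>S. of_int (zorder f a) * (1 / a ^ k))"
  proof (intro arg_cong2[where f="(+)"] refl sum.cong)
    fix a assume a: "a \<in> S"
    have "fps_nth (neg_log_deriv (?X a)) (k - 1) = (-1 / -a) ^ Suc (k - 1)"
      using S(1)[OF a] by (intro neg_log_deriv_linear) simp
    also have "\<dots> = 1 / a ^ k"
      using k by (simp add: power_divide)
    finally show "of_nat (nat (zorder f a)) * fps_nth (neg_log_deriv (?X a)) (k - 1) = of_int (zorder f a) * (1 / a ^ k)"
      by (subst m) simp
  qed
  finally have Fk: "fps_nth (neg_log_deriv F) (k - 1) = \<dots>" .
  \<comment> \<open>On the circle, |z - a| = |r^2 - cnj(a) z| / r, and the reflected factor has no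
    zero for |z| < r^2 / |a|, a radius exceeding r. So each linear factor reduces to the zero-free
    case; the divisor r is a constant, whose logarithmic derivative is 0.\<close>
  have linear: "((\<lambda>t. of_real (ln (cmod (of_real r * cis t - a))) * cis (- (real k * t))) has_integral
      - (?c * (cnj a ^ k / of_real r ^ (2 * k)))) {0..2*pi}" if a: "a \<in> S" for a
  proof -
    have *: "((\<lambda>t. of_real (ln (cmod (of_real (r\<^sup>2) - cnj a * (of_real r * cis t)))) * cis (- (real k * t)))
      has_integral - (?c * fps_nth (neg_log_deriv (fps_const (of_real (r\<^sup>2)) - fps_const (cnj a) * fps_X)) (k - 1)))
      {0..2*pi}"
    proof (rule has_integral_circle_log_zero_free[where \<rho>="r\<^sup>2 / cmod a"])
      show "r < r\<^sup>2 / cmod a"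
        using S[OF a] r by (simp add: field_simps power2_eq_square)
      fix z :: complex assume "z \<in> ball 0 (r\<^sup>2 / cmod a)"
      then have "cmod (cnj a * z) < cmod (of_real (r\<^sup>2))"
        using S[OF a] by (simp add: norm_mult norm_power field_simps)
      then show "of_real (r\<^sup>2) - cnj a * z \<noteq> 0"
        by auto
    qed (use r k in \<open>auto intro!: holomorphic_intros fps_expansion_intros\<close>)
    have c: "((\<lambda>t. of_real (ln (cmod (of_real r))) * cis (- (real k * t))) has_integral
        - (?c * fps_nth (neg_log_deriv (fps_const (of_real r))) (k - 1))) {0..2*pi}"
      by (rule has_integral_circle_log_zero_free[where \<rho>="r + 1"])
        (use r k in \<open>auto intro!: holomorphic_intros fps_expansion_intros\<close>)
    have "ln (cmod (of_real (r\<^sup>2) - cnj a * (of_real r * cis t))) - ln (cmod (of_real r)) =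
        ln (cmod (of_real r * cis t - a))" for t
    proof -
      have "of_real (r\<^sup>2) - cnj a * (of_real r * cis t) = of_real r * cis t * cnj (of_real r * cis t - a)"
        by (simp add: algebra_simps power2_eq_square cis_cnj flip: cis_inverse)
      then have "cmod (of_real (r\<^sup>2) - cnj a * (of_real r * cis t)) = r * cmod (of_real r * cis t - a)"
        using r by (simp add: norm_mult del: complex_cnj_diff)
      moreover have "of_real r * cis t \<noteq> a"
        using S[OF a] r by (auto simp: norm_mult)
      ultimately show ?thesis
        using r by (simp add: ln_mult)
    qed
    moreover have "- (?c * fps_nth (neg_log_deriv (fps_const (of_real (r\<^sup>2)) - fps_const (cnj a) * fps_X)) (k - 1))
       - - (?c * fps_nth (neg_log_deriv (fps_const (of_real r))) (k - 1)) = - (?c * (cnj a ^ k / of_real r ^ (2 * k)))"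
      using r k by (subst neg_log_deriv_linear) (auto simp: power_divide power_mult)
    ultimately show ?thesis
      using has_integral_diff[OF * c] by (simp only: left_diff_distrib[symmetric] of_real_diff[symmetric])
  qed
  have "((\<lambda>t. of_real (ln (cmod (h (of_real r * cis t)))) * cis (- (real k * t)) +
      (\<Sum>a\<in>S. of_int (zorder f a) * (of_real (ln (cmod (of_real r * cis t - a))) * cis (- (real k * t)))))
      has_integral - (?c * fps_nth (neg_log_deriv H) (k - 1)) +
        (\<Sum>a\<in>S. of_int (zorder f a) * - (?c * (cnj a ^ k / of_real r ^ (2 * k))))) {0..2*pi}"
    by (intro has_integral_add has_integral_sum finS has_integral_mult_right linear
        has_integral_circle_log_zero_free[OF h _ _ k H] r \<rho>)
  moreover have "of_real (ln (cmod (h (of_real r * cis t)))) * cis (- (real k * t)) +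
      (\<Sum>a\<in>S. of_int (zorder f a) * (of_real (ln (cmod (of_real r * cis t - a))) * cis (- (real k * t))))
     = of_real (ln (cmod (f (of_real r * cis t)))) * cis (- (real k * t))" for t
  proof -
    have z: "of_real r * cis t \<in> ball 0 \<rho>"
      using r \<rho> by (simp add: norm_mult)
    have ne: "of_real r * cis t - a \<noteq> 0" if "a \<in> S" for a
      using S[OF that] r by (auto simp: norm_mult)
    have "ln (cmod (f (of_real r * cis t))) = ln (cmod (h (of_real r * cis t))) +
        (\<Sum>a\<in>S. nat (zorder f a) * ln (cmod (of_real r * cis t - a)))"
      using h(2)[OF z] ne finS
      by (simp add: fh[OF z] norm_mult ln_mult prod_norm[symmetric] norm_power ln_prod ln_realpow prod_pos)
    also have "(\<Sum>a\<in>S. nat (zorder f a) * ln (cmod (of_real r * cis t - a))) =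
       (\<Sum>a\<in>S. of_int (zorder f a) * ln (cmod (of_real r * cis t - a)))"
      by (intro sum.cong refl) (subst (2) m, simp)
    finally show ?thesis
      by (simp add: algebra_simps sum_distrib_left)
  qed
  moreover have "- (?c * fps_nth (neg_log_deriv H) (k - 1)) +
        (\<Sum>a\<in>S. of_int (zorder f a) * - (?c * (cnj a ^ k / of_real r ^ (2 * k))))
     = ?c * ((\<Sum>a\<in>S. of_int (zorder f a) * (1 / a ^ k - cnj a ^ k / of_real r ^ (2 * k)))
          - fps_nth (neg_log_deriv F) (k - 1))"
    unfolding Fk by (simp add: algebra_simps sum_subtractf sum_distrib_left sum_negf del: One_nat_def)
  ultimately show ?thesis
    by (simp only:)
qed

section \<open>Power sums over zeros\<close>

definition gaf_fps :: "(nat \<Rightarrow> complex) \<Rightarrow> complex fps" where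
  "gaf_fps c = Abs_fps (\<lambda>j. c j / of_real (sqrt (fact j)))"

lemma gaf_eq_eval_fps: "gaf c = eval_fps (gaf_fps c)"
  by (simp add: fun_eq_iff gaf_def eval_fps_def gaf_fps_def)

text \<open>Summability is asked for at natural radii only: every |z| lies below one of them, and
  countably many radii allow the hypothesis to hold almost surely for all at once.\<close>

lemma
  assumes "\<And>R::nat. summable (\<lambda>j. cmod (c j) * (real R ^ j / sqrt (fact j)))"
  shows gaf_holomorphic: "gaf c holomorphic_on UNIV"
    and gaf_has_fps_expansion: "gaf c has_fps_expansion gaf_fps c"
proof -
  have conv: "fps_conv_radius (gaf_fps c) = \<infinity>"
    unfolding fps_conv_radius_def gaf_fps_def fps_nth_Abs_fps
  proof (rule conv_radius_inftyI'')
    fix z :: complex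
    obtain R :: nat where R: "cmod z \<le> real R"
      using real_arch_simple by blast
    show "summable (\<lambda>j. c j / of_real (sqrt (fact j)) * z ^ j)"
    proof (rule summable_comparison_test'[OF assms[of R]])
      fix j :: nat
      have "norm (c j / of_real (sqrt (fact j)) * z ^ j) = cmod (c j) * (cmod z ^ j / sqrt (fact j))"
        by (simp add: norm_mult norm_divide norm_power)
      also have "\<dots> \<le> cmod (c j) * (real R ^ j / sqrt (fact j))"
        using R by (intro mult_left_mono divide_right_mono power_mono) auto
      finally show "norm (c j / of_real (sqrt (fact j)) * z ^ j) \<le> \<dots>" .
    qed
  qed
  then show "gaf c has_fps_expansion gaf_fps c"
    unfolding gaf_eq_eval_fps by (intro eval_fps_has_fps_expansion) simp
  show "gaf c holomorphic_on UNIV"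
    unfolding gaf_eq_eval_fps by (rule holomorphic_on_eval_fps) (simp add: conv eball_def)
qed

section \<open>Power sums over the roots of polynomials\<close>

lemma zorder_poly:
  assumes "p \<noteq> 0"
  shows "zorder (poly p) a = int (order a p)"
proof -
  obtain q where q: "p = [:- a, 1:] ^ order a p * q" "\<not> [:- a, 1:] dvd q"
    using order_decomp[OF assms] by blast
  show ?thesis
  proof (rule zorder_eqI[of UNIV _ "poly q"])
    show "poly q a \<noteq> 0"
      using q(2) by (simp add: poly_eq_0_iff_dvd)
    fix w
    show "poly p w = poly q w * (w - a) powi int (order a p)"
      by (subst q(1)) (simp add: poly_power)
  qed (auto intro: poly_holomorphic_on)
qed

text \<open>By the fundamental theorem of algebra p is a constant times a product of powers (z -
  a)^m, so -p'/p is the sum of m / (a - z), which is expanded at 0.\<close>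

lemma sum_inverse_powers_poly_roots:
  assumes "poly p 0 \<noteq> 0" "1 \<le> k"
  shows "(\<Sum>a | poly p a = 0. of_int (zorder (poly p) a) * (1 / a ^ k)) =
    fps_nth (neg_log_deriv (fps_of_poly p)) (k - 1)"
proof -
  have p: "p \<noteq> 0"
    using assms by auto
  then have fin: "finite {a. poly p a = 0}"
    by (rule poly_roots_finite)
  let ?X = "\<lambda>a. fps_const (-a) - fps_const (-1) * fps_X"
  have minus_one: "fps_const (-1) = (-1 :: complex fps)"
    by (metis fps_const_neg fps_const_1_eq_1)
  have "fps_of_poly p = fps_of_poly (smult (lead_coeff p) (\<Prod>a | poly p a = 0. [:-a, 1:] ^ order a p))"
    by (simp only: complex_poly_decompose)
  also have "\<dots> = fps_const (lead_coeff p) * (\<Prod>a | poly p a = 0. ?X a ^ order a p)"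
    by (simp add: fps_of_poly_smult fps_of_poly_prod fps_of_poly_power fps_of_poly_pCons minus_one)
  finally have "neg_log_deriv (fps_of_poly p) = neg_log_deriv (fps_const (lead_coeff p) * (\<Prod>a | poly p a = 0. ?X a ^ order a p))"
    by simp
  also have "\<dots> = (\<Sum>a | poly p a = 0. of_nat (order a p) * neg_log_deriv (?X a))"
  proof (subst neg_log_deriv_mult)
    have nz: "fps_nth (?X a ^ order a p) 0 \<noteq> 0" if "a \<in> {a. poly p a = 0}" for a
      using that assms(1) by (auto simp: fps_power_zeroth)
    show "fps_nth (\<Prod>a | poly p a = 0. ?X a ^ order a p) 0 \<noteq> 0"
      using fin nz by (induction rule: finite_induct) auto
    have "neg_log_deriv (\<Prod>a | poly p a = 0. ?X a ^ order a p) = (\<Sum>a | poly p a = 0. neg_log_deriv (?X a ^ order a p))"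
      by (rule neg_log_deriv_prod[OF fin nz])
    also have "\<dots> = (\<Sum>a | poly p a = 0. of_nat (order a p) * neg_log_deriv (?X a))"
      using assms(1) by (intro sum.cong refl neg_log_deriv_power) auto
    finally show "neg_log_deriv (fps_const (lead_coeff p)) + neg_log_deriv (\<Prod>a | poly p a = 0. ?X a ^ order a p)
        = (\<Sum>a | poly p a = 0. of_nat (order a p) * neg_log_deriv (?X a))"
      by (simp only: neg_log_deriv_const add_0)
  qed (use p in simp)
  finally have "fps_nth (neg_log_deriv (fps_of_poly p)) (k - 1) =
      (\<Sum>a | poly p a = 0. of_nat (order a p) * fps_nth (neg_log_deriv (?X a)) (k - 1))"
    by (simp add: fps_sum_nth fps_of_nat[symmetric])
  also have "\<dots> = (\<Sum>a | poly p a = 0. of_int (zorder (poly p) a) * (1 / a ^ k))"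
  proof (intro sum.cong refl)
    fix a assume "a \<in> {a. poly p a = 0}"
    then have "a \<noteq> 0"
      using assms(1) by auto
    then have "fps_nth (neg_log_deriv (?X a)) (k - 1) = (-1 / -a) ^ Suc (k - 1)"
      by (intro neg_log_deriv_linear) simp
    also have "\<dots> = 1 / a ^ k"
      using assms(2) by (simp add: power_divide)
    finally show "of_nat (order a p) * fps_nth (neg_log_deriv (?X a)) (k - 1) = of_int (zorder (poly p) a) * (1 / a ^ k)"
      by (simp add: zorder_poly[OF p])
  qed
  finally show ?thesis ..
qed

lemma alpha_trunc_eq:
  assumes "c 0 \<noteq> 0" "1 \<le> k"
  shows "alpha_trunc r0 k n c = fps_nth (neg_log_deriv (gaf_fps (\<lambda>j. if j \<le> n then c j else 0))) (k - 1)"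
proof -
  define p where "p = (\<Sum>j\<le>n. monom (c j / of_real (sqrt (fact j))) j)"
  have poly_p: "poly p = gaf_trunc n c"
    by (simp add: p_def fun_eq_iff gaf_trunc_def poly_sum poly_monom)
  have coeff_p: "coeff p j = (if j \<le> n then c j / of_real (sqrt (fact j)) else 0)" for j
    by (auto simp: p_def coeff_sum coeff_monom)
  have p0: "poly p 0 \<noteq> 0"
    using assms(1) coeff_p[of 0] by (simp add: poly_0_coeff_0)
  then have fin: "finite {a. poly p a = 0}"
    by (intro poly_roots_finite) auto
  have "fps_of_poly p = gaf_fps (\<lambda>j. if j \<le> n then c j else 0)"
    by (rule fps_ext) (simp add: coeff_p gaf_fps_def)
  \<comment> \<open>The disk and its complement together contain every root, so \<open>r0\<close>
    drops out.\<close>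
  moreover have "alpha_trunc r0 k n c = (\<Sum>a | poly p a = 0. of_int (zorder (poly p) a) * (1 / a ^ k))"
    unfolding alpha_trunc_def zero_power_sum_def poly_p[symmetric]
    by (subst sum.union_disjoint[symmetric]) (auto intro!: sum.cong intro: finite_subset[OF _ fin])
  ultimately show ?thesis
    using sum_inverse_powers_poly_roots[OF p0 assms(2)] by simp
qed

text \<open>For n >= k the truncation leaves c_0, ..., c_k untouched, and coefficient k - 1 of -F'/F
  involves no others.\<close>

lemma alpha_trunc_eventually_const:
  assumes "c 0 \<noteq> 0" "1 \<le> k" "k \<le> n"
  shows "alpha_trunc r0 k n c = fps_nth (neg_log_deriv (gaf_fps c)) (k - 1)"
  unfolding alpha_trunc_eq[of c, OF assms(1,2)]
  using assms by (intro neg_log_deriv_nth_cong) (auto simp: gaf_fps_def)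

text \<open>Only finitely many zeros carry a non-zero value of \<open>u\<close>, so the integral is
  a finite sum. The orders are non-negative for an entire function that is not identically zero,
  hence passing them through \<open>ennreal\<close> loses nothing.\<close>

lemma integral_zero_measure:
  fixes u :: "complex \<Rightarrow> complex"
  assumes f: "f holomorphic_on UNIV" "f w \<noteq> 0"
    and S: "finite S" "S \<subseteq> {z. f z = 0}" "\<And>z. f z = 0 \<Longrightarrow> z \<notin> S \<Longrightarrow> u z = 0"
  shows "(\<integral>z. u z \<partial>zero_measure f) = (\<Sum>a\<in>S. of_int (zorder f a) * u a)"
proof -
  have "(\<integral>z. u z \<partial>zero_measure f) = (\<integral>z. real_of_int (zorder f z) *\<^sub>R u z \<partial>count_space {z. f z = 0})"
    unfolding zero_measure_def point_measure_def
    by (subst integral_density) (auto intro: zorder_nonneg_entire[OF f])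
  also have "\<dots> = (\<Sum>a\<in>S. of_int (zorder f a) * u a)"
  proof (subst lebesgue_integral_count_space_finite_support)
    have sub: "{z \<in> {z. f z = 0}. real_of_int (zorder f z) *\<^sub>R u z \<noteq> 0} \<subseteq> S"
      using S(3) by auto
    then show "finite {z \<in> {z. f z = 0}. real_of_int (zorder f z) *\<^sub>R u z \<noteq> 0}"
      using S(1) finite_subset by blast
    show "(\<Sum>a | a \<in> {z. f z = 0} \<and> real_of_int (zorder f a) *\<^sub>R u a \<noteq> 0. real_of_int (zorder f a) *\<^sub>R u a)
        = (\<Sum>a\<in>S. of_int (zorder f a) * u a)"
      using sub S(2) by (intro sum.mono_neutral_cong_left S(1)) (auto simp: scaleR_conv_of_real)
  qed
  finally show ?thesis .
qed

text \<open>Smoothness is given on the plane, whereas the averaging over radii needs a profile on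
  the half-line. Restricting to the real axis turns the derivative into the Frechet derivative in
  direction 1; the weight of the average involves the first two derivatives.\<close>

lemma
  fixes \<phi> :: "complex \<Rightarrow> real"
  assumes "C_infinity \<phi>"
  defines "D \<equiv> (\<lambda>x. frechet_derivative \<phi> (at x) 1)"
  shows cutoff_has_derivative: "((\<lambda>t. \<phi> (of_real t)) has_real_derivative D (of_real t)) (at t)"
    and cutoff_has_derivative2: "((\<lambda>t. D (of_real t)) has_real_derivative
      frechet_derivative D (at (of_real t)) 1) (at t)"
    and cutoff_continuous_derivative2: "continuous_on UNIV (\<lambda>t::real. frechet_derivative D (at (of_real t)) 1)"
proof -
  have C: "C_k (Suc (Suc 0)) \<phi>"
    using assms by (simp only: C_infinity_def)
  have *: "((\<lambda>t. f (of_real t)) has_real_derivative frechet_derivative f (at (of_real t)) 1) (at t)"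
    if "\<And>x. f differentiable (at x)" for f :: "complex \<Rightarrow> real" and t
  proof -
    have f: "(f has_derivative frechet_derivative f (at (of_real t))) (at (of_real t))"
      using that frechet_derivative_works by blast
    have "((\<lambda>t. f (of_real t)) has_derivative (\<lambda>h. frechet_derivative f (at (of_real t)) (of_real h))) (at t)"
      by (rule has_derivative_compose[where g=f and f=of_real, OF _ f]) (auto intro!: derivative_eq_intros)
    moreover have "frechet_derivative f (at (of_real t)) (of_real h) = frechet_derivative f (at (of_real t)) 1 * h" for h
      using linear_scale[OF has_derivative_linear[OF f], of h 1] by (simp add: scaleR_conv_of_real)
    ultimately show ?thesis
      by (simp add: has_field_derivative_def)
  qed
  show "((\<lambda>t. \<phi> (of_real t)) has_real_derivative D (of_real t)) (at t)"
    unfolding D_def using C by (intro *) simp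
  show "((\<lambda>t. D (of_real t)) has_real_derivative frechet_derivative D (at (of_real t)) 1) (at t)"
    unfolding D_def using C by (intro *) simp
  have "continuous_on UNIV (\<lambda>x. frechet_derivative D (at x) 1)"
    unfolding D_def using C by simp
  from continuous_on_compose2[OF this, of UNIV of_real]
  show "continuous_on UNIV (\<lambda>t::real. frechet_derivative D (at (of_real t)) 1)"
    by (auto intro: continuous_intros)
qed

section \<open>Smoothed power sums\<close>

lemma cis_measurable [measurable]: "cis \<in> borel_measurable borel"
  by (intro borel_measurable_continuous_onI continuous_intros)

text \<open>Differentiating \<open>q(\<rho>) = \<integral> (1 - (\<rho> / s)\<^sup>2\<^sup>k)\<^sub>+ g(s) ds\<close> twice
  and solving for \<open>g\<close> gives the weight.\<close>

lemma smoothing_kernel_has_integral: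
  fixes p D D2 :: "real \<Rightarrow> real"
  assumes p: "\<And>t. (p has_real_derivative D t) (at t)" and D: "\<And>t. (D has_real_derivative D2 t) (at t)"
    and r0: "0 < r0" and k: "1 \<le> k"
    and one: "\<And>t. 3 * r0 / 2 \<le> t \<Longrightarrow> t \<le> 2 * r0 \<Longrightarrow> p t = 1"
    and zero: "\<And>t. 3 * r0 \<le> t \<Longrightarrow> p t = 0"
    and \<rho>: "0 \<le> \<rho>"
  shows "((\<lambda>s. (s * D2 s - (2 * real k - 1) * D s) / (2 * real k) * max 0 (1 - (\<rho> / s) ^ (2 * k)))
    has_integral (if \<rho> \<le> 2 * r0 then 1 else p \<rho>)) {2 * r0..3 * r0}"
proof -
  let ?g = "\<lambda>s. (s * D2 s - (2 * real k - 1) * D s) / (2 * real k)"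
  have contD: "continuous_on S D" for S
    using D by (meson DERIV_isCont continuous_at_imp_continuous_on)
  \<comment> \<open>Constancy of \<open>p\<close> on an open interval passes to the closure by
    continuity of \<open>D\<close>. So \<open>D\<close> vanishes at 2 r0 and 3 r0, where boundary
    terms arise.\<close>
  have D0: "D t = 0" if "open S" "t \<in> closure S" "\<And>u. u \<in> S \<Longrightarrow> p u = c" for S t c
  proof (rule continuous_constant_on_closure[OF contD _ that(2)])
    fix u assume u: "u \<in> S"
    have "((\<lambda>_. c) has_real_derivative D u) (at u)"
      using p[of u] by (rule has_field_derivative_transform_within_open[OF _ that(1) u that(3)])
    then show "D u = 0"
      by (rule DERIV_unique) simp
  qed
  have D2r: "D (2 * r0) = 0"
    using r0 one by (intro D0[of "{3 * r0 / 2<..<2 * r0}" _ 1]) auto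
  have D3r: "D (3 * r0) = 0"
    using zero by (intro D0[of "{3 * r0<..}" _ 0]) auto
  \<comment> \<open>An antiderivative of the weight times the kernel without its positive part. It
    is explicit at the limits that occur: 0 at 3 r0, -1 at 2 r0, and -p(\<rho>) at \<rho>.\<close>
  define G where "G = (\<lambda>s. (1 - (\<rho> / s) ^ (2 * k)) * (s * D s) / (2 * real k) - p s)"
  have G: "(G has_real_derivative ?g s * (1 - (\<rho> / s) ^ (2 * k))) (at s)" if "0 < s" for s
  proof -
    have "((\<lambda>s. \<rho> / s) has_real_derivative - (\<rho> / s) / s) (at s)"
      using that by (auto intro!: derivative_eq_intros simp: power2_eq_square)
    note pow = DERIV_power[OF this, of "2 * k"]
    have "(\<rho> / s) ^ (2 * k - Suc 0) * (\<rho> / s) = (\<rho> / s) ^ (2 * k)"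
      using k by (metis One_nat_def mult_pos_pos power_minus_mult zero_less_numeral less_le_trans zero_less_one)
    moreover have "of_nat (2 * k) * (- (\<rho> / s) / s * (\<rho> / s) ^ (2 * k - Suc 0)) =
        - (2 * real k) * ((\<rho> / s) ^ (2 * k - Suc 0) * (\<rho> / s)) / s"
      by simp
    ultimately have "of_nat (2 * k) * (- (\<rho> / s) / s * (\<rho> / s) ^ (2 * k - Suc 0)) = - (2 * real k) * (\<rho> / s) ^ (2 * k) / s"
      by (simp only:)
    then have pow': "((\<lambda>s. (\<rho> / s) ^ (2 * k)) has_real_derivative - (2 * real k) * (\<rho> / s) ^ (2 * k) / s) (at s)"
      using pow by simp
    show ?thesis
      unfolding G_def
      by (rule DERIV_cong[OF DERIV_diff[OF DERIV_cdivide[OF DERIV_mult[OF DERIV_diff[OF DERIV_const pow']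
              DERIV_mult[OF DERIV_ident D]]] p]])
        (use that k in \<open>simp add: divide_simps; simp add: algebra_simps\<close>)
  qed
  have ftc: "((\<lambda>s. ?g s * (1 - (\<rho> / s) ^ (2 * k))) has_integral G (3 * r0) - G a) {a..3 * r0}"
    if "0 < a" "a \<le> 3 * r0" for a
    using that by (intro fundamental_theorem_of_calculus)
      (auto simp flip: has_real_derivative_iff_has_vector_derivative
        simp del: times_divide_eq_left intro!: has_field_derivative_at_within[OF G])
  have G3: "G (3 * r0) = 0"
    using zero by (simp add: G_def D3r)
  have le: "(\<rho> / s) ^ (2 * k) \<le> 1" if "\<rho> \<le> s" "0 < s" for s
    using that \<rho> by (intro power_le_one) auto
  have ge: "max 0 (1 - (\<rho> / s) ^ (2 * k)) = 0" if "s \<le> \<rho>" "0 < s" for s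
    using that \<rho> one_le_power[of "\<rho> / s" "2 * k"] by simp
  \<comment> \<open>The positive part is inactive, switches on at s = \<rho>, or annihilates the
    whole integrand.\<close>
  consider "\<rho> \<le> 2 * r0" | "2 * r0 < \<rho>" "\<rho> < 3 * r0" | "3 * r0 \<le> \<rho>"
    by linarith
  then show ?thesis
  proof cases
    case 1
    have "((\<lambda>s. ?g s * (1 - (\<rho> / s) ^ (2 * k))) has_integral 1) {2 * r0..3 * r0}"
      using ftc[of "2 * r0"] r0 one[of "2 * r0"] by (simp add: G3) (simp add: G_def D2r)
    then have "((\<lambda>s. ?g s * max 0 (1 - (\<rho> / s) ^ (2 * k))) has_integral 1) {2 * r0..3 * r0}"
      using 1 r0 le by (elim has_integral_eq[rotated]) (auto simp: max_def)
    then show ?thesis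
      using 1 by simp
  next
    case 2
    have "((\<lambda>s. ?g s * (1 - (\<rho> / s) ^ (2 * k))) has_integral p \<rho>) {\<rho>..3 * r0}"
      using ftc[of \<rho>] r0 2 by (simp add: G3) (simp add: G_def)
    then have "((\<lambda>s. ?g s * max 0 (1 - (\<rho> / s) ^ (2 * k))) has_integral p \<rho>) {\<rho>..3 * r0}"
      using 2 r0 le by (elim has_integral_eq[rotated]) (auto simp: max_def)
    moreover have "((\<lambda>s. ?g s * max 0 (1 - (\<rho> / s) ^ (2 * k))) has_integral 0) {2 * r0..\<rho>}"
      using r0 by (intro has_integral_is_0) (simp add: ge)
    ultimately have "((\<lambda>s. ?g s * max 0 (1 - (\<rho> / s) ^ (2 * k))) has_integral 0 + p \<rho>) {2 * r0..3 * r0}"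
      using 2 by (intro has_integral_combine[of "2 * r0" \<rho> "3 * r0"]) auto
    then show ?thesis
      using 2 by simp
  next
    case 3
    have "((\<lambda>s. ?g s * max 0 (1 - (\<rho> / s) ^ (2 * k))) has_integral 0) {2 * r0..3 * r0}"
      using r0 3 by (intro has_integral_is_0) (simp add: ge)
    then show ?thesis
      using 3 r0 zero by simp
  qed
qed

text \<open>Passage from gauge integrals, in which the Fourier identities are stated, to integrals
  in \<open>ennreal\<close>, where expectations can be exchanged with them by Tonelli.\<close>

lemma norm_has_integral_le_nn_integral:
  fixes h :: "real \<Rightarrow> 'a::euclidean_space"
  assumes "continuous_on {a..b} h" "(h has_integral I) {a..b}"
  shows "ennreal (norm I) \<le> (\<integral>\<^sup>+t\<in>{a..b}. ennreal (norm (h t)) \<partial>lborel)"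
proof -
  have int: "set_integrable lborel {a..b} h"
    using assms(1) by (rule borel_integrable_atLeastAtMost')
  have "I = (\<integral>t. indicator {a..b} t *\<^sub>R h t \<partial>lborel)"
    using set_borel_integral_eq_integral(2)[OF int] integral_unique[OF assms(2)]
    by (simp add: set_lebesgue_integral_def)
  also have "ennreal (norm \<dots>) \<le> (\<integral>\<^sup>+t. ennreal (norm (indicator {a..b} t *\<^sub>R h t)) \<partial>lborel)"
    using int by (intro integral_norm_bound_ennreal) (simp add: set_integrable_def)
  also have "\<dots> = (\<integral>\<^sup>+t\<in>{a..b}. ennreal (norm (h t)) \<partial>lborel)"
    by (intro nn_integral_cong) (simp split: split_indicator)
  finally show ?thesis .
qed

text \<open>The k-th Fourier coefficient of a constant is 0 as k >= 1, so \<open>m\<close> may be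
  subtracted from ln |f| in Jensen's formula before absolute values are taken. A value close to the
  typical size of ln |f| makes the bound useful.\<close>

lemma circle_log_bound:
  fixes m :: real
  assumes f: "f holomorphic_on UNIV" "f 0 \<noteq> 0" "f has_fps_expansion F"
    and r: "0 < r" "\<And>z. cmod z = r \<Longrightarrow> f z \<noteq> 0" and k: "1 \<le> k"
  shows "ennreal (cmod ((\<Sum>a | a \<in> ball 0 r \<and> f a = 0.
        of_int (zorder f a) * (1 / a ^ k - cnj a ^ k / of_real r ^ (2 * k))) - fps_nth (neg_log_deriv F) (k - 1)))
    \<le> ennreal (k / (pi * r ^ k)) *
       (\<integral>\<^sup>+t\<in>{0..2*pi}. ennreal \<bar>ln (cmod (f (of_real r * cis t))) - m\<bar> \<partial>lborel)" (is "ennreal (cmod ?B) \<le> _ * ?N")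
proof -
  \<comment> \<open>The constant function exp m is zero-free with logarithmic derivative 0, which
    gives the orthogonality of m to the k-th frequency.\<close>
  have "((\<lambda>t. of_real (ln (cmod (of_real (exp m)))) * cis (- (real k * t))) has_integral
      - (of_real (pi * r ^ k / k) * fps_nth (neg_log_deriv (fps_const (of_real (exp m)))) (k - 1))) {0..2*pi}"
    using r k by (intro has_integral_circle_log_zero_free[where h="\<lambda>_. of_real (exp m)" and \<rho>="r + 1"]) auto
  then have "((\<lambda>t. of_real m * cis (- (real k * t))) has_integral 0) {0..2*pi}"
    by simp
  from has_integral_diff[OF has_integral_circle_log[OF f r k] this]
  have int: "((\<lambda>t. of_real (ln (cmod (f (of_real r * cis t))) - m) * cis (- (real k * t))) has_integral
      of_real (pi * r ^ k / k) * ?B) {0..2*pi}"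
    by (simp add: left_diff_distrib)
  have contf: "continuous_on UNIV f"
    using f(1) by (rule holomorphic_on_imp_continuous_on)
  have nz: "f (of_real r * cis t) \<noteq> 0" for t
    using r by (simp add: norm_mult)
  have "continuous_on {0..2*pi} (\<lambda>t. of_real (ln (cmod (f (of_real r * cis t))) - m) * cis (- (real k * t)))"
    using nz by (intro continuous_intros continuous_on_compose2[OF contf]) auto
  from norm_has_integral_le_nn_integral[OF this int]
  have "ennreal (pi * r ^ k / k * cmod ?B) \<le> ?N"
    using r by (simp add: norm_mult norm_divide norm_power del: of_real_diff)
  then have "ennreal (k / (pi * r ^ k)) * ennreal (pi * r ^ k / k * cmod ?B) \<le> ennreal (k / (pi * r ^ k)) * ?N"
    by (rule mult_left_mono) simp
  also have "ennreal (k / (pi * r ^ k)) * ennreal (pi * r ^ k / k * cmod ?B) = ennreal (cmod ?B)"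
    using r k by (simp add: ennreal_mult[symmetric])
  finally show ?thesis .
qed

text \<open>Averages \<open>circle_log_bound\<close> over the radii R s with weight
  \<open>g\<close>. The kernel hypothesis turns the Jensen weights into the profile
  \<open>q\<close>; at \<rho> = 0 it says that \<open>g\<close> has integral q(0) = 1, so the
  coefficient of -F'/F is reproduced unchanged.\<close>

lemma smoothed_log_bound:
  fixes g q m :: "real \<Rightarrow> real"
  assumes f: "f holomorphic_on UNIV" "f 0 \<noteq> 0" "f has_fps_expansion F"
    and R: "0 < R" and r0: "0 < r0" and k: "1 \<le> k"
    and g: "continuous_on {2 * r0..3 * r0} g" "\<And>s. s \<in> {2 * r0..3 * r0} \<Longrightarrow> \<bar>g s\<bar> \<le> G"
    and kernel: "\<And>\<rho>. 0 \<le> \<rho> \<Longrightarrow>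
      ((\<lambda>s. g s * max 0 (1 - (\<rho> / s) ^ (2 * k))) has_integral q \<rho>) {2 * r0..3 * r0}"
    and q0: "q 0 = 1" and m [measurable]: "m \<in> borel_measurable borel"
  shows "ennreal (cmod ((\<Sum>a | cmod a < 3 * r0 * R \<and> f a = 0.
        of_int (zorder f a) * (of_real (q (cmod a / R)) / a ^ k)) - fps_nth (neg_log_deriv F) (k - 1)))
    \<le> ennreal (G * k / (pi * (2 * r0 * R) ^ k)) *
       (\<integral>\<^sup>+s\<in>{2 * r0..3 * r0}. (\<integral>\<^sup>+t\<in>{0..2*pi}.
          ennreal \<bar>ln (cmod (f (of_real (R * s) * cis t))) - m (R * s)\<bar> \<partial>lborel) \<partial>lborel)"
proof -
  define S where "S = {a. cmod a < 3 * r0 * R \<and> f a = 0}"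
  have finS: "finite S"
    unfolding S_def using finite_zeros_entire[OF f(1,2) compact_cball[of 0 "3 * r0 * R"]]
    by (rule rev_finite_subset) auto
  let ?A = "fps_nth (neg_log_deriv F) (k - 1)"
  let ?w = "\<lambda>a. of_int (zorder f a) / a ^ k :: complex"
  \<comment> \<open>\<open>B s\<close> is the difference bounded in \<open>circle_log_bound\<close>
    at radius R s, but summed over a set independent of s: the positive part removes the zeros
    beyond the radius. This also makes it continuous in s.\<close>
  define B where "B s = (\<Sum>a\<in>S. ?w a * of_real (max 0 (1 - (cmod a / R / s) ^ (2 * k)))) - ?A" for s
  have "((\<lambda>s. (\<Sum>a\<in>S. ?w a * of_real (g s * max 0 (1 - (cmod a / R / s) ^ (2 * k)))) -
        ?A * of_real (g s * max 0 (1 - (0 / s) ^ (2 * k)))) has_integral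
      (\<Sum>a\<in>S. ?w a * of_real (q (cmod a / R))) - ?A * of_real (q 0)) {2 * r0..3 * r0}"
    using R by (intro has_integral_diff has_integral_sum finS has_integral_mult_right has_integral_of_real kernel) auto
  also have "(\<lambda>s. (\<Sum>a\<in>S. ?w a * of_real (g s * max 0 (1 - (cmod a / R / s) ^ (2 * k)))) -
        ?A * of_real (g s * max 0 (1 - (0 / s) ^ (2 * k)))) = (\<lambda>s. of_real (g s) * B s)"
    using k by (auto simp: fun_eq_iff B_def algebra_simps sum_distrib_left power_0_left)
  finally have int: "((\<lambda>s. of_real (g s) * B s) has_integral
      (\<Sum>a\<in>S. ?w a * of_real (q (cmod a / R))) - ?A) {2 * r0..3 * r0}"
    by (simp add: q0)
  have "continuous_on {2 * r0..3 * r0} (\<lambda>s. of_real (g s) * B s)"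
    unfolding B_def using r0 R by (intro continuous_intros g) auto
  from norm_has_integral_le_nn_integral[OF this int]
  have "ennreal (cmod ((\<Sum>a\<in>S. ?w a * of_real (q (cmod a / R))) - ?A)) \<le>
      (\<integral>\<^sup>+s\<in>{2 * r0..3 * r0}. ennreal (cmod (of_real (g s) * B s)) \<partial>lborel)" .
  also have "\<dots> \<le> (\<integral>\<^sup>+s. ennreal (G * k / (pi * (2 * r0 * R) ^ k)) *
      ((\<integral>\<^sup>+t\<in>{0..2*pi}. ennreal \<bar>ln (cmod (f (of_real (R * s) * cis t))) - m (R * s)\<bar> \<partial>lborel) *
        indicator {2 * r0..3 * r0} s) \<partial>lborel)"
  proof (rule nn_integral_mono_AE)
    \<comment> \<open>Radii whose circle meets a zero are excluded from
      \<open>circle_log_bound\<close>; there are finitely many in the range, a null set.\<close>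
    have "finite ((\<lambda>a. cmod a / R) ` {a \<in> cball 0 (3 * r0 * R). f a = 0})"
      by (intro finite_imageI finite_zeros_entire[OF f(1,2)] compact_cball)
    then have "AE s in lborel. s \<notin> (\<lambda>a. cmod a / R) ` {a \<in> cball 0 (3 * r0 * R). f a = 0}"
      by (intro AE_not_in finite_imp_null_set_lborel)
    then show "AE s in lborel. ennreal (cmod (of_real (g s) * B s)) * indicator {2 * r0..3 * r0} s
       \<le> ennreal (G * k / (pi * (2 * r0 * R) ^ k)) *
         ((\<integral>\<^sup>+t\<in>{0..2*pi}. ennreal \<bar>ln (cmod (f (of_real (R * s) * cis t))) - m (R * s)\<bar> \<partial>lborel) *
           indicator {2 * r0..3 * r0} s)"
    proof eventually_elim
      case (elim s)
      show ?case
      proof (cases "s \<in> {2 * r0..3 * r0}")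
        case True
        let ?r = "R * s"
        let ?N = "\<integral>\<^sup>+t\<in>{0..2*pi}. ennreal \<bar>ln (cmod (f (of_real ?r * cis t))) - m ?r\<bar> \<partial>lborel"
        have s: "0 < s" and r: "0 < ?r"
          using True r0 R by auto
        have nz: "f z \<noteq> 0" if "cmod z = ?r" for z
        proof
          assume "f z = 0"
          then have "s \<in> (\<lambda>a. cmod a / R) ` {a \<in> cball 0 (3 * r0 * R). f a = 0}"
            using that True R by (intro image_eqI[of _ _ z]) (auto simp: mult.commute)
          then show False
            using elim by simp
        qed
        have "(\<Sum>a\<in>S. ?w a * of_real (max 0 (1 - (cmod a / R / s) ^ (2 * k)))) =
          (\<Sum>a | a \<in> ball 0 ?r \<and> f a = 0.
            of_int (zorder f a) * (1 / a ^ k - cnj a ^ k / of_real ?r ^ (2 * k)))"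
        proof (intro sum.mono_neutral_cong_right finS ballI)
          have "?r \<le> 3 * r0 * R"
            using True R by (simp add: mult.commute)
          then show "{a. a \<in> ball 0 ?r \<and> f a = 0} \<subseteq> S"
            by (auto simp: S_def)
          fix a assume "a \<in> S - {a. a \<in> ball 0 ?r \<and> f a = 0}"
          then have "1 \<le> cmod a / R / s"
            using R s by (auto simp: S_def field_simps)
          then have "1 \<le> (cmod a / R / s) ^ (2 * k)"
            by (rule one_le_power)
          then show "?w a * of_real (max 0 (1 - (cmod a / R / s) ^ (2 * k))) = 0"
            by simp
        next
          fix a assume a: "a \<in> {a. a \<in> ball 0 ?r \<and> f a = 0}"
          then have "a \<noteq> 0"
            using f(2) by auto
          have "cmod a / R / s \<le> 1"
            using a R s by (simp add: field_simps)
          then have "(cmod a / R / s) ^ (2 * k) \<le> 1"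
            using R s by (intro power_le_one) auto
          \<comment> \<open>After division by a^k, the factor \<open>cnj a ^ k\<close> remains: this
            is the conjugate power in Jensen's formula.\<close>
          moreover have "of_real ((cmod a / R / s) ^ (2 * k)) = a ^ k * cnj a ^ k / of_real ?r ^ (2 * k)"
          proof -
            have "of_real ((cmod a)\<^sup>2) ^ k = a ^ k * cnj a ^ k"
              by (simp only: complex_norm_square power_mult_distrib)
            then show ?thesis
              by (simp add: power_divide power_mult)
          qed
          ultimately have "?w a * of_real (max 0 (1 - (cmod a / R / s) ^ (2 * k))) =
            ?w a * (1 - a ^ k * cnj a ^ k / of_real ?r ^ (2 * k))"
            by (simp only: max_absorb2 diff_ge_0_iff_ge of_real_diff of_real_1)
          also have "\<dots> = of_int (zorder f a) * (1 / a ^ k - cnj a ^ k / of_real ?r ^ (2 * k))"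
            using \<open>a \<noteq> 0\<close> by (simp add: right_diff_distrib)
          finally show "?w a * of_real (max 0 (1 - (cmod a / R / s) ^ (2 * k))) =
            of_int (zorder f a) * (1 / a ^ k - cnj a ^ k / of_real ?r ^ (2 * k))" .
        qed
        then have "ennreal (cmod (B s)) \<le> ennreal (k / (pi * ?r ^ k)) * ?N"
          unfolding B_def using circle_log_bound[OF f r nz k, of "m ?r"] by simp
        moreover have "ennreal \<bar>g s\<bar> \<le> ennreal G"
          using g(2)[OF True] by (rule ennreal_leI)
        ultimately have "ennreal \<bar>g s\<bar> * ennreal (cmod (B s)) \<le> ennreal G * (ennreal (k / (pi * ?r ^ k)) * ?N)"
          by (intro mult_mono) auto
        also have "\<dots> = ennreal (G * (k / (pi * ?r ^ k))) * ?N"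
          using g(2)[OF True] r unfolding mult.assoc[symmetric] by (subst ennreal_mult[symmetric]) auto
        also have "\<dots> \<le> ennreal (G * k / (pi * (2 * r0 * R) ^ k)) * ?N"
        proof (intro mult_right_mono ennreal_leI)
          have "2 * r0 * R \<le> ?r"
            using True R by (simp add: mult.commute)
          then have "(2 * r0 * R) ^ k \<le> ?r ^ k"
            using r0 R by (intro power_mono) auto
          moreover have "0 \<le> G"
            using g(2)[OF True] by linarith
          ultimately show "G * (k / (pi * ?r ^ k)) \<le> G * k / (pi * (2 * r0 * R) ^ k)"
            using r0 R r by (auto intro!: divide_left_mono mult_left_mono mult_pos_pos zero_less_power)
        qed simp
        finally show ?thesis
          using True by (simp add: norm_mult ennreal_mult)
      qed simp
    qed
  qed
  also have "\<dots> = ennreal (G * k / (pi * (2 * r0 * R) ^ k)) *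
      (\<integral>\<^sup>+s\<in>{2 * r0..3 * r0}. (\<integral>\<^sup>+t\<in>{0..2*pi}.
        ennreal \<bar>ln (cmod (f (of_real (R * s) * cis t))) - m (R * s)\<bar> \<partial>lborel) \<partial>lborel)"
  proof (rule nn_integral_cmult)
    have [measurable]: "f \<in> borel_measurable borel"
      using f(1) by (intro borel_measurable_continuous_onI holomorphic_on_imp_continuous_on)
    show "(\<lambda>s. (\<integral>\<^sup>+t\<in>{0..2*pi}. ennreal \<bar>ln (cmod (f (of_real (R * s) * cis t))) - m (R * s)\<bar> \<partial>lborel) *
        indicator {2 * r0..3 * r0} s) \<in> borel_measurable lborel"
      by measurable
  qed
  finally show ?thesis
    by (simp add: S_def)
qed

section \<open>The dyadic cutoffs and their telescoping sum\<close>

definition radial_cutoff :: "real \<Rightarrow> (complex \<Rightarrow> real) \<Rightarrow> real \<Rightarrow> real" where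
  "radial_cutoff r0 \<phi> t = (if t \<le> 2 * r0 then 1 else \<phi> (of_real t))"

context
  fixes r0 :: real and \<phi> :: "complex \<Rightarrow> real"
  assumes r0: "0 < r0" and cutoff: "cutoff r0 \<phi>"
begin

lemma cutoff_radial: "\<phi> z = \<phi> (of_real (cmod z))"
  using cutoff unfolding cutoff_def by (metis norm_of_real abs_norm_cancel)

lemma cutoff_eq_1: "3 * r0 / 2 \<le> t \<Longrightarrow> t \<le> 2 * r0 \<Longrightarrow> \<phi> (of_real t) = 1"
  using cutoff unfolding cutoff_def by blast

lemma cutoff_overlap: "0 \<le> r \<Longrightarrow> r \<le> r0 / 2 \<Longrightarrow> \<phi> (of_real (r0 + r)) = 1 - \<phi> (of_real (2 * r0 + 2 * r))"
  using cutoff unfolding cutoff_def by blast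

lemma cutoff_eq_0:
  assumes "0 \<le> t" "t \<le> r0 \<or> 3 * r0 \<le> t"
  shows "\<phi> (of_real t) = 0"
\<comment> \<open>The support condition leaves the two boundary radii open; there the overlap
  relation, taken at its end points, yields 0.\<close>
proof (cases "t = r0 \<or> t = 3 * r0")
  case True
  then show ?thesis
    using cutoff_overlap[of 0] cutoff_overlap[of "r0 / 2"] cutoff_eq_1[of "3 * r0 / 2"] cutoff_eq_1[of "2 * r0"] r0
    by (auto simp: field_simps)
next
  case False
  then have "\<not> (r0 \<le> cmod (of_real t) \<and> cmod (of_real t) \<le> 3 * r0)"
    using assms by auto
  then show ?thesis
    using cutoff unfolding cutoff_def by blast
qed

lemma radial_cutoff_0: "cmod a < 3 * r0 \<Longrightarrow>
    (if cmod a < r0 then 1 else 0) + cutoff_tilde r0 \<phi> a = radial_cutoff r0 \<phi> (cmod a)"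
  using cutoff_eq_0[of "cmod a"] cutoff_eq_1[of "cmod a"] r0
  unfolding cutoff_tilde_def radial_cutoff_def by (subst cutoff_radial) auto

text \<open>For r0 < t <= 3 r0 / 2 this is the overlap relation \<phi>(t) = 1 - \<phi>(2 t);
  elsewhere one of the two summands on the left vanishes.\<close>

lemma radial_cutoff_step:
  assumes "0 \<le> t"
  shows "radial_cutoff r0 \<phi> (2 * t) + \<phi> (of_real t) = radial_cutoff r0 \<phi> t"
proof -
  consider "t \<le> r0" | "r0 < t" "t \<le> 3 * r0 / 2" | "3 * r0 / 2 \<le> t" "t \<le> 2 * r0" | "2 * r0 < t"
    by linarith
  then show ?thesis
  proof cases
    case 1
    then show ?thesis
      using assms r0 cutoff_eq_0[of t] by (simp add: radial_cutoff_def)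
  next
    case 2
    then show ?thesis
      using r0 cutoff_overlap[of "t - r0"] by (simp add: radial_cutoff_def algebra_simps)
  next
    case 3
    then show ?thesis
      using r0 cutoff_eq_0[of "2 * t"] cutoff_eq_1[of t] by (simp add: radial_cutoff_def)
  next
    case 4
    then show ?thesis
      using r0 cutoff_eq_0[of "2 * t"] by (simp add: radial_cutoff_def)
  qed
qed

lemma radial_cutoff_eq_0: "3 * r0 \<le> t \<Longrightarrow> radial_cutoff r0 \<phi> t = 0"
  using cutoff_eq_0[of t] r0 by (simp add: radial_cutoff_def)

lemma cutoff_tilde_eq_0: "3 * r0 \<le> cmod z \<Longrightarrow> cutoff_tilde r0 \<phi> z = 0"
  using cutoff_eq_0[of "cmod z"] r0 cutoff_radial[of z] by (simp add: cutoff_tilde_def)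

lemma rescale_eq:
  assumes "0 < L"
  shows "rescale L \<phi> z = \<phi> (of_real (cmod z / L))"
  unfolding rescale_def using assms by (subst cutoff_radial) (simp add: norm_divide)

text \<open>Each new cutoff moves the outer edge of the profile out by one dyadic scale, so the
  disk, the inner cutoff and the first J rescaled cutoffs merge into one profile stretched by
  2^J.\<close>

lemma radial_cutoff_telescope:
  assumes "cmod a < 3 * r0 * 2 ^ J"
  shows "(if cmod a < r0 then 1 else 0) + cutoff_tilde r0 \<phi> a + (\<Sum>j<J. rescale (2 ^ Suc j) \<phi> a)
    = radial_cutoff r0 \<phi> (cmod a / 2 ^ J)"
proof -
  have 0: "(if cmod a < r0 then 1 else 0) + cutoff_tilde r0 \<phi> a = radial_cutoff r0 \<phi> (cmod a)"
  proof (cases "cmod a < 3 * r0")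
    case False
    then show ?thesis
      using r0 cutoff_tilde_eq_0[of a] radial_cutoff_eq_0[of "cmod a"] by simp
  qed (rule radial_cutoff_0)
  show ?thesis
    unfolding 0
  proof (induction J)
    case (Suc J)
    have "radial_cutoff r0 \<phi> (cmod a) + (\<Sum>j<Suc J. rescale (2 ^ Suc j) \<phi> a) =
        radial_cutoff r0 \<phi> (2 * (cmod a / 2 ^ Suc J)) + \<phi> (of_real (cmod a / 2 ^ Suc J))"
      using Suc.IH by (simp add: rescale_eq)
    then show ?case
      by (simp only:) (rule radial_cutoff_step, simp)
  qed simp
qed

text \<open>The cutoffs up to scale 2^J vanish at all but the finitely many zeros with |a| < 3 r0
  2^J, so the partial sums are finite sums weighted by the profile. Their convergence is what gives
  the \<open>suminf\<close> in \<open>S_outer\<close> its intended value.\<close>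

lemma S_outer_eqI:
  assumes f: "f holomorphic_on UNIV" "f w \<noteq> 0"
    and lim: "(\<lambda>J. \<Sum>a | cmod a < 3 * r0 * 2 ^ J \<and> f a = 0.
      of_int (zorder f a) * (of_real (radial_cutoff r0 \<phi> (cmod a / 2 ^ J)) / a ^ k)) \<longlonglongrightarrow> A"
  shows "zero_power_sum f (ball 0 r0) k + S_outer r0 \<phi> k f = A"
proof -
  let ?K = "\<integral>z. of_real (cutoff_tilde r0 \<phi> z) / z ^ k \<partial>zero_measure f"
  let ?I = "\<lambda>j. \<integral>z. of_real (rescale (2 ^ Suc j) \<phi> z) / z ^ k \<partial>zero_measure f"
  let ?Z = "zero_power_sum f (ball 0 r0) k"
  have partial: "?Z + ?K + (\<Sum>j<J. ?I j) = (\<Sum>a | cmod a < 3 * r0 * 2 ^ J \<and> f a = 0.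
      of_int (zorder f a) * (of_real (radial_cutoff r0 \<phi> (cmod a / 2 ^ J)) / a ^ k))" for J
  proof -
    define S where "S = {a. cmod a < 3 * r0 * 2 ^ J \<and> f a = 0}"
    have finS: "finite S"
      unfolding S_def using finite_zeros_entire[OF f compact_cball[of 0 "3 * r0 * 2 ^ J"]]
      by (rule rev_finite_subset) auto
    have big: "3 * r0 * 2 ^ j \<le> 3 * r0 * 2 ^ J" if "j \<le> J" for j
      using r0 that by (intro mult_left_mono power_increasing) auto
    have in_S: "a \<in> S" if "f a = 0" "cmod a < 3 * r0 * 2 ^ j" "j \<le> J" for a j
      unfolding S_def using that(1,2) big[OF that(3)] by (intro CollectI conjI) linarith+
    have Z: "?Z = (\<Sum>a\<in>S. of_int (zorder f a) * (of_real (if cmod a < r0 then 1 else 0) / a ^ k))"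
      unfolding zero_power_sum_def
    proof (intro sum.mono_neutral_cong_left finS ballI)
      show "{z \<in> ball 0 r0. f z = 0} \<subseteq> S"
        using in_S[of _ 0] r0 by force
    qed (auto simp: S_def)
    have K: "?K = (\<Sum>a\<in>S. of_int (zorder f a) * (of_real (cutoff_tilde r0 \<phi> a) / a ^ k))"
    proof (intro integral_zero_measure[OF f] finS)
      fix z assume "f z = 0" "z \<notin> S"
      then have "3 * r0 \<le> cmod z"
        using in_S[of z 0] by force
      then show "of_real (cutoff_tilde r0 \<phi> z) / z ^ k = 0"
        by (simp add: cutoff_tilde_eq_0)
    qed (auto simp: S_def)
    have I: "?I j = (\<Sum>a\<in>S. of_int (zorder f a) * (of_real (rescale (2 ^ Suc j) \<phi> a) / a ^ k))" if "j < J" for j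
    proof (intro integral_zero_measure[OF f] finS)
      fix z assume "f z = 0" "z \<notin> S"
      then have "3 * r0 * 2 ^ Suc j \<le> cmod z"
        using in_S[of z "Suc j"] that by force
      then have "\<phi> (of_real (cmod z / 2 ^ Suc j)) = 0"
        by (intro cutoff_eq_0) (auto simp: field_simps)
      then have "rescale (2 ^ Suc j) \<phi> z = 0"
        by (simp only: rescale_eq zero_less_power zero_less_numeral)
      then show "of_real (rescale (2 ^ Suc j) \<phi> z) / z ^ k = 0"
        by simp
    qed (auto simp: S_def)
    have "?Z + ?K + (\<Sum>j<J. ?I j) = (\<Sum>a\<in>S. of_int (zorder f a) *
        (of_real ((if cmod a < r0 then 1 else 0) + cutoff_tilde r0 \<phi> a + (\<Sum>j<J. rescale (2 ^ Suc j) \<phi> a)) / a ^ k))"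
    proof -
      have "(\<Sum>j<J. ?I j) = (\<Sum>j<J. \<Sum>a\<in>S. of_int (zorder f a) * (of_real (rescale (2 ^ Suc j) \<phi> a) / a ^ k))"
        by (intro sum.cong refl I) simp
      also have "\<dots> = (\<Sum>a\<in>S. \<Sum>j<J. of_int (zorder f a) * (of_real (rescale (2 ^ Suc j) \<phi> a) / a ^ k))"
        by (rule sum.swap)
      finally show ?thesis
        unfolding Z K
        by (simp add: sum_distrib_left add_divide_distrib ring_distribs sum.distrib sum_divide_distrib)
    qed
    also have "\<dots> = (\<Sum>a\<in>S. of_int (zorder f a) * (of_real (radial_cutoff r0 \<phi> (cmod a / 2 ^ J)) / a ^ k))"
      by (intro sum.cong refl arg_cong2[where f="(*)"] arg_cong2[where f="(/)"] arg_cong[where f=of_real]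
          radial_cutoff_telescope) (simp add: S_def)
    finally show ?thesis
      by (simp add: S_def)
  qed
  have "(\<lambda>J. ?Z + ?K + (\<Sum>j<J. ?I j) - (?Z + ?K)) \<longlonglongrightarrow> A - (?Z + ?K)"
    unfolding partial by (intro tendsto_intros lim)
  then have "(\<lambda>j. ?I j) sums (A - (?Z + ?K))"
    by (simp add: sums_def)
  then show ?thesis
    by (simp add: S_outer_def sums_unique[symmetric])
qed

end

section \<open>Moments of the logarithm of the Gaussian analytic function\<close>

text \<open>Infinite at \<open>0\<close>, so that bounds by it absorb the junk value \<open>ln 0 = 0\<close>.\<close>

definition log_majorant :: "complex \<Rightarrow> ennreal" where
  "log_majorant z = (\<Sum>n. indicator (cball 0 (exp (- real n))) z)"

lemma log_majorant_measurable [measurable]: "log_majorant \<in> borel_measurable borel"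
  unfolding log_majorant_def by (intro borel_measurable_suminf_order borel_measurable_indicator borel_closed closed_cball)

lemma log_majorant_0: "log_majorant 0 = \<infinity>"
proof -
  have "ennreal (real n) \<le> log_majorant 0" for n
  proof -
    have "(\<Sum>i<n. indicator (cball 0 (exp (- real i))) (0::complex) :: ennreal) \<le> log_majorant 0"
      unfolding log_majorant_def by (intro sum_le_suminf) auto
    then show ?thesis
      by (simp add: ennreal_of_nat_eq_real_of_nat)
  qed
  then show ?thesis
    by (metis ennreal_Ex_less_of_nat ennreal_of_nat_eq_real_of_nat infinity_ennreal_def not_le less_top)
qed

text \<open>Every index n below the ceiling of - ln |z| contributes 1 to the series, because z lies
  in the n-th disk.\<close>

lemma log_majorant_ge:
  assumes "z \<noteq> 0"
  shows "ennreal (- ln (cmod z)) \<le> log_majorant z"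
proof (cases "cmod z \<le> 1")
  case True
  define n where "n = nat \<lceil>- ln (cmod z)\<rceil>"
  have "0 \<le> - ln (cmod z)"
    using True assms by simp
  have "i \<le> - ln (cmod z)" if "i < n" for i
    using that unfolding n_def by linarith
  then have "cmod z \<le> exp (- real i)" if "i < n" for i
    using that assms by (metis (no_types) exp_le_cancel_iff exp_ln le_minus_iff zero_less_norm_iff)
  then have "ennreal (real n) = (\<Sum>i<n. indicator (cball 0 (exp (- real i))) z)"
    by (simp add: ennreal_of_nat_eq_real_of_nat)
  also have "\<dots> \<le> log_majorant z"
    unfolding log_majorant_def by (intro sum_le_suminf) auto
  finally have "ennreal (real n) \<le> log_majorant z" .
  moreover have "- ln (cmod z) \<le> real n"
    unfolding n_def by linarith
  ultimately show ?thesis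
    using ennreal_leI order_trans by blast
next
  case False
  then have "- ln (cmod z) \<le> 0"
    by simp
  then show ?thesis
    by (simp add: ennreal_neg)
qed

text \<open>For |z| >= 1, ln |z| = ln (|z| / T) + ln T <= |z| / T + ln T. The parameter T trades the
  mean of |z| against a logarithm; later it bounds the ratio of the sum of the weights to the
  largest one.\<close>

lemma abs_ln_le_log_majorant:
  assumes "1 \<le> T" "z \<noteq> 0"
  shows "ennreal \<bar>ln (cmod z)\<bar> \<le> ennreal (cmod z / T + ln T) + log_majorant z"
proof (cases "1 \<le> cmod z")
  case True
  have "ln (cmod z / T) \<le> cmod z / T - 1"
    using assms True by (intro ln_le_minus_one) auto
  then have "\<bar>ln (cmod z)\<bar> \<le> cmod z / T + ln T"
    using assms True by (simp add: ln_div)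
  then have "ennreal \<bar>ln (cmod z)\<bar> \<le> ennreal (cmod z / T + ln T)"
    by (rule ennreal_leI)
  then show ?thesis
    by (metis add.right_neutral add_mono zero_le)
next
  case False
  then have "ennreal \<bar>ln (cmod z)\<bar> = ennreal (- ln (cmod z))"
    using assms by simp
  also have "\<dots> \<le> log_majorant z"
    by (rule log_majorant_ge[OF assms(2)])
  finally show ?thesis
    by (metis add.left_neutral add_mono zero_le)
qed

lemma std_complex_normal_density_measurable [measurable]:
  "std_complex_normal_density \<in> borel_measurable borel"
  unfolding std_complex_normal_density_def by measurable

text \<open>The density is at most 1 / \<pi>, and the disk of radius e^(-n) has area \<pi> e^(-2n)
  wherever it is centred. The result is a geometric series, uniform in the shift
  \<open>b\<close>.\<close>

lemma nn_integral_normal_log_majorant: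
  "(\<integral>\<^sup>+z. ennreal (std_complex_normal_density z) * log_majorant (z + b) \<partial>lborel) \<le> ennreal (1 / (1 - exp (-2)))"
proof -
  have shift: "(indicator (cball 0 r) (z + b) :: ennreal) = indicator (cball (-b) r) z" for r z
    by (auto simp: indicator_def dist_norm norm_minus_commute algebra_simps)
  have vol: "emeasure lborel (cball (-b) (exp (- real n))) = ennreal (pi * exp (-2) ^ n)" for n
    by (subst emeasure_cball)
       (auto simp: unit_ball_vol_2 power2_eq_square ennreal_mult[symmetric] exp_of_nat_mult[symmetric] simp flip: exp_add)
  have "(\<integral>\<^sup>+z. ennreal (std_complex_normal_density z) * log_majorant (z + b) \<partial>lborel)
      \<le> (\<integral>\<^sup>+z. ennreal (1 / pi) * log_majorant (z + b) \<partial>lborel)"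
    by (intro nn_integral_mono mult_right_mono ennreal_leI)
       (auto simp: std_complex_normal_density_def divide_right_mono)
  also have "\<dots> = ennreal (1 / pi) * (\<Sum>n. emeasure lborel (cball (-b) (exp (- real n))))"
    by (subst nn_integral_cmult)
       (auto simp: log_majorant_def shift intro!: arg_cong2[where f="(*)"] nn_integral_suminf[THEN trans]
         borel_measurable_suminf_order borel_measurable_indicator)
  also have "\<dots> = ennreal (1 / pi) * ennreal (\<Sum>n. pi * exp (-2) ^ n)"
    unfolding vol by (subst suminf_ennreal2) (auto intro!: summable_mult summable_geometric)
  also have "\<dots> = ennreal (1 / (1 - exp (-2)))"
    by (simp add: suminf_mult summable_geometric suminf_geometric ennreal_mult'[symmetric] field_simps)
  finally show ?thesis .
qed

lemma nn_integral_normal_cmod: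
  "(\<integral>\<^sup>+z. ennreal (std_complex_normal_density z) * ennreal (cmod z) \<partial>lborel) < \<infinity>"
proof -
  let ?e = "\<lambda>x::real. ennreal (exp (- x\<^sup>2 / 2))"
  have "(\<integral>\<^sup>+z. ennreal (std_complex_normal_density z) * ennreal (cmod z) \<partial>lborel)
      \<le> (\<integral>\<^sup>+z. (\<Prod>b\<in>(Basis :: complex set). ?e (z \<bullet> b)) \<partial>lborel)"
  proof (intro nn_integral_mono)
    fix z :: complex
    \<comment> \<open>Half of the Gaussian decay absorbs |z|; the other half factors over real and
      imaginary part.\<close>
    have "cmod z \<le> 1 + (cmod z)\<^sup>2 / 2"
      using zero_le_power2[of "cmod z - 1"] by (simp add: power2_eq_square algebra_simps)
    also have "\<dots> \<le> exp ((cmod z)\<^sup>2 / 2)"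
      by (rule exp_ge_add_one_self)
    finally have "exp (- (cmod z)\<^sup>2) * cmod z \<le> exp (- (cmod z)\<^sup>2) * exp ((cmod z)\<^sup>2 / 2)"
      by (rule mult_left_mono) simp
    also have "\<dots> = exp (- (Re z)\<^sup>2 / 2) * exp (- (Im z)\<^sup>2 / 2)"
      by (simp add: cmod_power2 flip: exp_add) (simp add: field_simps)
    finally have "exp (- (cmod z)\<^sup>2) * cmod z \<le> exp (- (Re z)\<^sup>2 / 2) * exp (- (Im z)\<^sup>2 / 2)" .
    moreover have "std_complex_normal_density z * cmod z \<le> exp (- (cmod z)\<^sup>2) * cmod z"
      using pi_ge_two mult_right_mono[of 1 pi "exp (- (cmod z)\<^sup>2) * cmod z"]
      by (simp add: std_complex_normal_density_def divide_le_eq mult_ac)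
    ultimately show "ennreal (std_complex_normal_density z) * ennreal (cmod z) \<le> (\<Prod>b\<in>Basis. ?e (z \<bullet> b))"
      by (simp add: Basis_complex_def ennreal_mult[symmetric] std_complex_normal_density_def complex_inner_1_right complex_inner_i_right)
  qed
  also have "\<dots> = (\<Prod>b\<in>(Basis :: complex set). \<integral>\<^sup>+x. ?e x \<partial>lborel)"
    by (rule nn_integral_lborel_prod) auto
  also have "\<dots> < \<infinity>"
  proof -
    have "(\<integral>\<^sup>+x. ?e x \<partial>lborel) = (\<integral>\<^sup>+x. ennreal (sqrt (2 * pi)) * ennreal (normal_density 0 1 x) \<partial>lborel)"
      by (intro nn_integral_cong) (simp add: normal_density_def ennreal_mult[symmetric])
    also have "\<dots> = ennreal (sqrt (2 * pi)) * (\<integral>\<^sup>+x. ennreal (normal_density 0 1 x) \<partial>lborel)"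
      by (rule nn_integral_cmult) simp
    also have "(\<integral>\<^sup>+x. ennreal (normal_density 0 1 x) \<partial>lborel) = 1"
      by (subst nn_integral_eq_integral) (auto intro: integrable_normal_density simp: integral_normal_density)
    finally show ?thesis
      by (simp add: ennreal_mult_less_top Basis_complex_def)
  qed
  finally show ?thesis .
qed

text \<open>The supremum is formed in \<open>ennreal\<close>, where its measurability in r is
  automatic. For r > 0 it is attained, so \<open>enn2real\<close> loses nothing.\<close>

definition max_term :: "real \<Rightarrow> real" where
  "max_term r = enn2real (SUP j::nat. ennreal (r ^ j / sqrt (fact j)))"

lemma max_term_measurable [measurable]: "max_term \<in> borel_measurable borel"
  unfolding max_term_def by measurable

text \<open>Consecutive weights have ratio r / sqrt (j + 1), at most 1 / 2 from index J = ceiling of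
  4 r^2 on. So the tail is at most twice the largest weight, the terms before it at most J times,
  and J + 2 <= 4 r^2 + 3.\<close>

lemma
  assumes r: "0 < r"
  shows summable_weights: "summable (\<lambda>j. r ^ j / sqrt (fact j))"
    and max_term_attained: "\<exists>N. max_term r = r ^ N / sqrt (fact N)"
    and suminf_weights_le: "(\<Sum>j. r ^ j / sqrt (fact j)) \<le> (4 * r\<^sup>2 + 3) * max_term r"
proof -
  define w where "w j = r ^ j / sqrt (fact j)" for j
  define J where "J = nat \<lceil>4 * r\<^sup>2\<rceil>"
  have w_pos: "0 < w j" for j
    using r by (simp add: w_def)
  have w_half: "w (Suc j) \<le> w j / 2" if "J \<le> j" for j
  proof -
    have "(2 * r)\<^sup>2 \<le> real (Suc j)"
      using that unfolding J_def by (simp add: power2_eq_square)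
    then have "2 * r \<le> sqrt (real (Suc j))"
      by (rule real_le_rsqrt)
    then have "r / sqrt (real (Suc j)) \<le> 1 / 2"
      by (simp add: field_simps)
    then have "w j * (r / sqrt (real (Suc j))) \<le> w j * (1 / 2)"
      using w_pos[of j] by (intro mult_left_mono) auto
    then show ?thesis
      by (simp add: w_def real_sqrt_mult mult.commute)
  qed
  have tail: "w (i + J) \<le> w J * (1 / 2) ^ i" for i
  proof (induction i)
    case (Suc i)
    have "w (Suc i + J) \<le> w (i + J) / 2"
      using w_half[of "i + J"] by simp
    then show ?case
      using Suc.IH by simp
  qed simp
  have summable_tail: "summable (\<lambda>i. w (i + J))"
    by (rule summable_comparison_test'[of "\<lambda>i. w J * (1 / 2) ^ i"])
      (use tail w_pos in \<open>auto simp: less_imp_le intro!: summable_mult summable_geometric\<close>)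
  then have summable_w: "summable w"
    by (simp only: summable_iff_shift)
  then show "summable (\<lambda>j. r ^ j / sqrt (fact j))"
    by (simp add: w_def[abs_def])
  obtain N where N: "N \<le> J" "\<And>j. j \<le> J \<Longrightarrow> w j \<le> w N"
  proof -
    have "Max (w ` {..J}) \<in> w ` {..J}"
      by (intro Max_in) auto
    then obtain N where "N \<le> J" "w N = Max (w ` {..J})"
      by (metis imageE atMost_iff)
    then show thesis
      by (intro that) auto
  qed
  have w_le: "w j \<le> w N" for j
  proof (cases "j \<le> J")
    case False
    then obtain i where "j = i + J"
      by (metis add.commute le_Suc_ex nat_le_linear)
    then have "w j \<le> w J * (1 / 2) ^ i"
      using tail by simp
    also have "\<dots> \<le> w J * 1"
      using w_pos[of J] by (intro mult_left_mono power_le_one) auto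
    finally show ?thesis
      using N(2)[of J] by simp
  qed (rule N)
  have max: "max_term r = w N"
  proof -
    have "(SUP j. ennreal (w j)) = ennreal (w N)"
      using w_le by (intro antisym SUP_least SUP_upper ennreal_leI) auto
    then show ?thesis
      using w_pos[of N] by (simp add: max_term_def w_def)
  qed
  then show "\<exists>N. max_term r = r ^ N / sqrt (fact N)"
    unfolding w_def by blast
  have "(\<Sum>j. w j) = (\<Sum>i. w (i + J)) + (\<Sum>j<J. w j)"
    using summable_w by (rule suminf_split_initial_segment)
  also have "(\<Sum>i. w (i + J)) \<le> (\<Sum>i. w J * (1 / 2) ^ i)"
    using tail by (intro suminf_le summable_tail summable_mult summable_geometric) auto
  also have "\<dots> = 2 * w J"
    by (simp add: suminf_mult suminf_geometric summable_geometric)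
  also have "\<dots> \<le> 2 * w N"
    using w_le by simp
  also have "(\<Sum>j<J. w j) \<le> real J * w N"
    using sum_bounded_above[of "{..<J}" w "w N"] w_le by simp
  finally have "(\<Sum>j. w j) \<le> (2 + real J) * w N"
    by (simp add: algebra_simps)
  also have "\<dots> \<le> (4 * r\<^sup>2 + 3) * w N"
  proof (rule mult_right_mono)
    have "0 \<le> 4 * r\<^sup>2"
      by simp
    then show "2 + real J \<le> 4 * r\<^sup>2 + 3"
      unfolding J_def by linarith
  qed (use w_pos[of N] in simp)
  finally show "(\<Sum>j. r ^ j / sqrt (fact j)) \<le> (4 * r\<^sup>2 + 3) * max_term r"
    unfolding max w_def .
qed

lemma gaf_measurable [measurable (raw)]:
  assumes [measurable]: "\<And>j. (\<lambda>x. c x j) \<in> borel_measurable N" "z \<in> borel_measurable N"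
  shows "(\<lambda>x. gaf (c x) (z x)) \<in> borel_measurable N"
  unfolding gaf_def by measurable

section \<open>Expectations over the Gaussian coefficients\<close>

context prob_space
begin

context
  fixes \<xi> :: "nat \<Rightarrow> 'a \<Rightarrow> complex"
  assumes iid: "iid_std_complex_gaussian M \<xi>"
begin

lemma gaussian_measurable [measurable]: "\<xi> j \<in> borel_measurable M"
  using iid distributed_measurable unfolding iid_std_complex_gaussian_def by fastforce

lemma nn_integral_gaussian:
  assumes [measurable]: "g \<in> borel_measurable borel"
  shows "(\<integral>\<^sup>+\<omega>. g (\<xi> j \<omega>) \<partial>M) = (\<integral>\<^sup>+z. ennreal (std_complex_normal_density z) * g z \<partial>lborel)"
proof -
  have "distributed M lborel (\<xi> j) (\<lambda>z. ennreal (std_complex_normal_density z))"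
    using iid by (simp add: iid_std_complex_gaussian_def)
  then show ?thesis
    by (rule distributed_nn_integral[symmetric]) simp
qed

text \<open>\<open>log_majorant\<close> has finite expectation but is infinite at 0.\<close>

lemma gaussian_AE_nonzero: "AE \<omega> in M. \<xi> j \<omega> \<noteq> 0"
proof -
  have "(\<integral>\<^sup>+\<omega>. log_majorant (\<xi> j \<omega>) \<partial>M) \<le> ennreal (1 / (1 - exp (-2)))"
    using nn_integral_normal_log_majorant[of 0] by (simp add: nn_integral_gaussian)
  then have "(\<integral>\<^sup>+\<omega>. log_majorant (\<xi> j \<omega>) \<partial>M) \<noteq> \<infinity>"
    by (auto simp: top_unique)
  then have "AE \<omega> in M. log_majorant (\<xi> j \<omega>) \<noteq> \<infinity>"
    by (rule nn_integral_noteq_infinite[rotated]) measurable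
  then show ?thesis
    by eventually_elim (use log_majorant_0 in auto)
qed

lemma nn_integral_weighted_gaussian_sum:
  assumes "\<And>j. 0 \<le> w j" "summable w"
  shows "(\<integral>\<^sup>+\<omega>. (\<Sum>j. ennreal (cmod (\<xi> j \<omega>) * w j)) \<partial>M) =
    ennreal (\<Sum>j. w j) * (\<integral>\<^sup>+z. ennreal (std_complex_normal_density z) * ennreal (cmod z) \<partial>lborel)"
proof -
  have "(\<integral>\<^sup>+\<omega>. (\<Sum>j. ennreal (cmod (\<xi> j \<omega>) * w j)) \<partial>M) = (\<Sum>j. \<integral>\<^sup>+\<omega>. ennreal (cmod (\<xi> j \<omega>) * w j) \<partial>M)"
    by (rule nn_integral_suminf) measurable
  also have "\<dots> = (\<Sum>j. ennreal (w j) * (\<integral>\<^sup>+z. ennreal (std_complex_normal_density z) * ennreal (cmod z) \<partial>lborel))"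
    using assms(1) nn_integral_gaussian[of "\<lambda>z. ennreal (cmod z)"]
    by (simp add: ennreal_mult' mult.commute[of _ "ennreal (w _)"] nn_integral_cmult)
  also have "\<dots> = (\<Sum>j. ennreal (w j)) * (\<integral>\<^sup>+z. ennreal (std_complex_normal_density z) * ennreal (cmod z) \<partial>lborel)"
    by (rule ennreal_suminf_multc)
  also have "(\<Sum>j. ennreal (w j)) = ennreal (\<Sum>j. w j)"
    using assms by (intro suminf_ennreal2) auto
  finally show ?thesis .
qed

lemma gaussian_AE_summable:
  "AE \<omega> in M. \<forall>R::nat. summable (\<lambda>j. cmod (\<xi> j \<omega>) * (real R ^ j / sqrt (fact j)))"
  unfolding AE_all_countable
proof
  fix R :: nat
  have *: "summable (\<lambda>j. real R ^ j / sqrt (fact j))"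
  proof (cases "R = 0")
    case True
    then show ?thesis
      by (intro summable_finite[of "{0}"]) auto
  qed (auto intro!: summable_weights)
  have "(\<integral>\<^sup>+\<omega>. (\<Sum>j. ennreal (cmod (\<xi> j \<omega>) * (real R ^ j / sqrt (fact j)))) \<partial>M) \<noteq> \<infinity>"
    using nn_integral_normal_cmod
    by (subst nn_integral_weighted_gaussian_sum[OF _ *]) (auto simp: ennreal_mult_eq_top_iff less_top)
  then have "AE \<omega> in M. (\<Sum>j. ennreal (cmod (\<xi> j \<omega>) * (real R ^ j / sqrt (fact j)))) \<noteq> \<infinity>"
    by (rule nn_integral_noteq_infinite[rotated]) measurable
  then show "AE \<omega> in M. summable (\<lambda>j. cmod (\<xi> j \<omega>) * (real R ^ j / sqrt (fact j)))"
    by eventually_elim (intro summable_suminf_not_top, auto)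
qed

text \<open>Conditionally on the other coefficients, \<open>\<xi> N\<close> still has a bounded density.\<close>

lemma nn_integral_log_majorant_shift:
  fixes h :: "(nat \<Rightarrow> complex) \<Rightarrow> complex"
  assumes h [measurable]: "h \<in> borel_measurable (PiM (- {N}) (\<lambda>_. borel))"
  shows "(\<integral>\<^sup>+\<omega>. log_majorant (\<xi> N \<omega> + h (\<lambda>j\<in>- {N}. \<xi> j \<omega>)) \<partial>M) \<le> ennreal (1 / (1 - exp (-2)))"
proof -
  define Y where "Y \<omega> = h (\<lambda>j\<in>- {N}. \<xi> j \<omega>)" for \<omega>
  have "indep_vars (\<lambda>_. borel) \<xi> UNIV"
    using iid by (simp add: iid_std_complex_gaussian_def)
  then have "indep_var (PiM {N} (\<lambda>_. borel)) (\<lambda>\<omega>. \<lambda>j\<in>{N}. \<xi> j \<omega>) (PiM (- {N}) (\<lambda>_. borel)) (\<lambda>\<omega>. \<lambda>j\<in>- {N}. \<xi> j \<omega>)"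
    by (rule indep_var_restrict) auto
  from indep_var_compose[OF this, of "\<lambda>c. c N" borel h borel]
  have "indep_var borel (\<xi> N) borel Y"
    by (simp add: comp_def Y_def[abs_def])
  then have Y [measurable]: "Y \<in> borel_measurable M" and
    dist: "distr M borel (\<xi> N) \<Otimes>\<^sub>M distr M borel Y = distr M (borel \<Otimes>\<^sub>M borel) (\<lambda>\<omega>. (\<xi> N \<omega>, Y \<omega>))"
    unfolding indep_var_distribution_eq by auto
  interpret X: prob_space "distr M borel (\<xi> N)"
    by (rule prob_space_distr) simp
  interpret Y: prob_space "distr M borel Y"
    by (rule prob_space_distr) simp
  interpret XY: pair_sigma_finite "distr M borel (\<xi> N)" "distr M borel Y" ..
  have "(\<integral>\<^sup>+\<omega>. log_majorant (\<xi> N \<omega> + Y \<omega>) \<partial>M) =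
      (\<integral>\<^sup>+p. log_majorant (fst p + snd p) \<partial>(distr M borel (\<xi> N) \<Otimes>\<^sub>M distr M borel Y))"
    unfolding dist by (subst nn_integral_distr) auto
  \<comment> \<open>The coefficient \<open>\<xi> N\<close> is integrated first, with
    \<open>Y\<close> frozen at y; the bound is uniform in y.\<close>
  also have "\<dots> = (\<integral>\<^sup>+y. \<integral>\<^sup>+x. log_majorant (x + y) \<partial>distr M borel (\<xi> N) \<partial>distr M borel Y)"
    by (subst XY.nn_integral_snd[symmetric]) auto
  also have "\<dots> \<le> (\<integral>\<^sup>+y. ennreal (1 / (1 - exp (-2))) \<partial>distr M borel Y)"
  proof (intro nn_integral_mono)
    fix y
    show "(\<integral>\<^sup>+x. log_majorant (x + y) \<partial>distr M borel (\<xi> N)) \<le> ennreal (1 / (1 - exp (-2)))"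
      using nn_integral_normal_log_majorant[of y] nn_integral_gaussian[of "\<lambda>x. log_majorant (x + y)" N]
      by (simp add: nn_integral_distr)
  qed
  also have "\<dots> = ennreal (1 / (1 - exp (-2)))"
    by (simp add: Y.emeasure_space_1[simplified])
  finally show ?thesis
    by (simp add: Y_def)
qed

text \<open>Division by the maximal term without its coefficient gives f / q = \<xi>_N + h with h
  independent of \<xi>_N. The shifted majorant then controls the negative part of the logarithm, and
  the mean of |f| / (T |q|), at most E|\<xi>|, together with ln T the positive part.\<close>

lemma nn_integral_log_gaf:
  assumes z: "z \<noteq> 0"
  shows "(\<integral>\<^sup>+\<omega>. ennreal \<bar>ln (cmod (gaf (\<lambda>j. \<xi> j \<omega>) z)) - ln (max_term (cmod z))\<bar> \<partial>M) \<le>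
    (\<integral>\<^sup>+z. ennreal (std_complex_normal_density z) * ennreal (cmod z) \<partial>lborel) +
    ennreal (ln (4 * (cmod z)\<^sup>2 + 3)) + ennreal (1 / (1 - exp (-2)))"
proof -
  define r where "r = cmod z"
  define w where "w j = r ^ j / sqrt (fact j)" for j
  define T where "T = 4 * r\<^sup>2 + 3"
  have r: "0 < r"
    using z by (simp add: r_def)
  have T: "1 \<le> T"
    by (simp add: T_def add.commute add_increasing2)
  have w_nonneg: "0 \<le> w j" for j
    using r by (simp add: w_def)
  obtain N where N: "max_term r = w N"
    using max_term_attained[OF r] unfolding w_def by blast
  define q where "q = z ^ N / of_real (sqrt (fact N))"
  have q: "cmod q = max_term r" "0 < max_term r"
  proof -
    show "cmod q = max_term r"
      unfolding N by (simp add: q_def w_def r_def norm_divide norm_power)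
    show "0 < max_term r"
      unfolding N using r by (simp add: w_def)
  qed
  then have q0: "q \<noteq> 0"
    by auto
  \<comment> \<open>Coefficient N is overwritten by 0, so \<open>h\<close> makes sense on restricted
    families, whose value at N is \<open>undefined\<close>.\<close>
  define h where "h c = gaf (\<lambda>j. if j = N then 0 else c j) z / q" for c
  have h: "h \<in> borel_measurable (PiM (- {N}) (\<lambda>_. borel))"
  proof -
    have [measurable]: "(\<lambda>c. if j = N then 0 else c j) \<in> borel_measurable (PiM (- {N}) (\<lambda>_. borel))" for j
      by (cases "j = N") (auto intro: measurable_component_singleton)
    show ?thesis
      unfolding h_def by measurable
  qed
  have "AE \<omega> in M. ennreal \<bar>ln (cmod (gaf (\<lambda>j. \<xi> j \<omega>) z)) - ln (max_term r)\<bar> \<le>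
      ennreal (1 / (max_term r * T)) * (\<Sum>j. ennreal (cmod (\<xi> j \<omega>) * w j)) + ennreal (ln T) +
      log_majorant (\<xi> N \<omega> + h (\<lambda>j\<in>- {N}. \<xi> j \<omega>))"
    using gaussian_AE_summable
  proof eventually_elim
    case (elim \<omega>)
    define c where "c j = \<xi> j \<omega>" for j
    let ?a = "\<lambda>j. c j / of_real (sqrt (fact j)) * z ^ j"
    obtain R :: nat where R: "r \<le> real R"
      using real_arch_simple by blast
    have norm_a: "cmod (?a j) = cmod (c j) * w j" for j
      by (simp add: w_def r_def norm_mult norm_divide norm_power)
    have sum_w: "summable (\<lambda>j. cmod (c j) * w j)"
    proof (rule summable_comparison_test')
      show "summable (\<lambda>j. cmod (c j) * (real R ^ j / sqrt (fact j)))"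
        using elim by (simp add: c_def)
      show "norm (cmod (c j) * w j) \<le> cmod (c j) * (real R ^ j / sqrt (fact j))" for j
        using R r by (auto simp: w_def abs_mult intro!: mult_left_mono divide_right_mono power_mono)
    qed
    then have sum_a: "summable (\<lambda>j. cmod (?a j))"
      by (simp only: norm_a)
    have "cmod (gaf c z) \<le> (\<Sum>j. cmod (c j) * w j)"
      unfolding gaf_def norm_a[symmetric] by (rule summable_norm[OF sum_a])
    then have "ennreal (cmod (gaf c z)) \<le> ennreal (\<Sum>j. cmod (c j) * w j)"
      by (rule ennreal_leI)
    also have "\<dots> = (\<Sum>j. ennreal (cmod (c j) * w j))"
      using sum_w w_nonneg by (intro suminf_ennreal2[symmetric]) auto
    finally have upper: "ennreal (cmod (gaf c z)) \<le> (\<Sum>j. ennreal (cmod (c j) * w j))" .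
    have "(\<lambda>j. if j = N then ?a N else 0) sums ?a N"
      using sums_single[of N ?a] by (simp add: eq_commute cong: if_cong)
    then have "(\<lambda>j. ?a j - (if j = N then ?a N else 0)) sums (gaf c z - ?a N)"
      unfolding gaf_def by (intro sums_diff summable_sums[OF summable_norm_cancel[OF sum_a]])
    then have "gaf (\<lambda>j. if j = N then 0 else c j) z = gaf c z - ?a N"
      unfolding gaf_def by (intro sums_unique[symmetric]) (auto elim!: sums_cong[THEN iffD1, rotated])
    moreover have "h (\<lambda>j\<in>- {N}. \<xi> j \<omega>) = gaf (\<lambda>j. if j = N then 0 else c j) z / q"
      unfolding h_def c_def by (intro arg_cong2[where f="(/)"] arg_cong2[where f=gaf]) auto
    moreover have "?a N = c N * q"
      by (simp add: q_def)
    ultimately have "h (\<lambda>j\<in>- {N}. \<xi> j \<omega>) = (gaf c z - c N * q) / q"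
      by (simp only:)
    then have x: "\<xi> N \<omega> + h (\<lambda>j\<in>- {N}. \<xi> j \<omega>) = gaf c z / q"
      using q0 by (simp add: diff_divide_distrib c_def)
    show ?case
    \<comment> \<open>If f vanishes at z, the left side contains the default
      \<open>ln 0 = 0\<close>, and the right side is infinite.\<close>
    proof (cases "gaf c z = 0")
      case True
      then show ?thesis
        unfolding x by (simp add: log_majorant_0)
    next
      case False
      have "\<bar>ln (cmod (gaf c z)) - ln (max_term r)\<bar> = \<bar>ln (cmod (gaf c z / q))\<bar>"
        using False q0 q by (simp add: norm_divide ln_div)
      then have "ennreal \<bar>ln (cmod (gaf c z)) - ln (max_term r)\<bar> \<le>
          ennreal (cmod (gaf c z / q) / T + ln T) + log_majorant (gaf c z / q)"
        using abs_ln_le_log_majorant[OF T, of "gaf c z / q"] False q0 by simp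
      also have "ennreal (cmod (gaf c z / q) / T + ln T) =
          ennreal (1 / (max_term r * T)) * ennreal (cmod (gaf c z)) + ennreal (ln T)"
        using T q by (simp add: norm_divide ennreal_plus[symmetric] ennreal_mult[symmetric] del: ennreal_plus)
      also have "\<dots> \<le> ennreal (1 / (max_term r * T)) * (\<Sum>j. ennreal (cmod (c j) * w j)) + ennreal (ln T)"
        by (intro add_mono mult_left_mono upper) auto
      finally show ?thesis
        unfolding c_def[symmetric] x[unfolded c_def[symmetric]] by (simp add: add_right_mono)
    qed
  qed
  then have "(\<integral>\<^sup>+\<omega>. ennreal \<bar>ln (cmod (gaf (\<lambda>j. \<xi> j \<omega>) z)) - ln (max_term r)\<bar> \<partial>M) \<le>
      (\<integral>\<^sup>+\<omega>. ennreal (1 / (max_term r * T)) * (\<Sum>j. ennreal (cmod (\<xi> j \<omega>) * w j)) + ennreal (ln T) +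
      log_majorant (\<xi> N \<omega> + h (\<lambda>j\<in>- {N}. \<xi> j \<omega>)) \<partial>M)"
    by (rule nn_integral_mono_AE)
  also have "\<dots> = ennreal (1 / (max_term r * T)) * (\<integral>\<^sup>+\<omega>. (\<Sum>j. ennreal (cmod (\<xi> j \<omega>) * w j)) \<partial>M) +
      ennreal (ln T) + (\<integral>\<^sup>+\<omega>. log_majorant (\<xi> N \<omega> + h (\<lambda>j\<in>- {N}. \<xi> j \<omega>)) \<partial>M)"
  proof -
    have [measurable]: "(\<lambda>\<omega>. h (\<lambda>j\<in>- {N}. \<xi> j \<omega>)) \<in> borel_measurable M"
      by (rule measurable_compose[OF measurable_restrict h]) simp
    show ?thesis
      by (simp add: nn_integral_add nn_integral_cmult emeasure_space_1)
  qed
  also have "\<dots> \<le> (\<integral>\<^sup>+z. ennreal (std_complex_normal_density z) * ennreal (cmod z) \<partial>lborel) +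
      ennreal (ln T) + ennreal (1 / (1 - exp (-2)))"
  proof (intro add_mono nn_integral_log_majorant_shift h order_refl)
    let ?E = "\<integral>\<^sup>+z. ennreal (std_complex_normal_density z) * ennreal (cmod z) \<partial>lborel"
    \<comment> \<open>The reason for the choice of \<open>T\<close>: it bounds the sum of the
      weights relative to the largest one, so the prefactor brings the expectation down to
      E|\<xi>|.\<close>
    have "(\<Sum>j. w j) \<le> T * max_term r"
      using suminf_weights_le[OF r] by (simp add: w_def T_def)
    then have "1 / (max_term r * T) * (\<Sum>j. w j) \<le> 1"
      using T q by (simp add: field_simps)
    then have "ennreal (1 / (max_term r * T) * (\<Sum>j. w j)) * ?E \<le> 1 * ?E"
      by (intro mult_right_mono) auto
    moreover have "ennreal (1 / (max_term r * T)) * (\<integral>\<^sup>+\<omega>. (\<Sum>j. ennreal (cmod (\<xi> j \<omega>) * w j)) \<partial>M) =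
        ennreal (1 / (max_term r * T) * (\<Sum>j. w j)) * ?E"
    proof -
      have sw: "summable w"
        using summable_weights[OF r] by (simp add: w_def[abs_def])
      show ?thesis
        unfolding nn_integral_weighted_gaussian_sum[OF w_nonneg sw] mult.assoc[symmetric]
        using T q suminf_nonneg[OF sw w_nonneg] by (subst ennreal_mult) auto
    qed
    ultimately show "ennreal (1 / (max_term r * T)) * (\<integral>\<^sup>+\<omega>. (\<Sum>j. ennreal (cmod (\<xi> j \<omega>) * w j)) \<partial>M) \<le> ?E"
      by simp
  qed
  finally show ?thesis
    by (simp add: r_def T_def)
qed

end

end

section \<open>Almost sure convergence\<close>

text \<open>The right side of \<open>smoothed_log_bound\<close> with m = ln \<open>max_term\<close>:
  an integral over an annulus in polar coordinates, without the Jacobian.\<close>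

definition log_deviation :: "real \<Rightarrow> (nat \<Rightarrow> complex) \<Rightarrow> real \<Rightarrow> ennreal" where
  "log_deviation r0 c R = (\<integral>\<^sup>+s\<in>{2 * r0..3 * r0}. (\<integral>\<^sup>+t\<in>{0..2*pi}.
     ennreal \<bar>ln (cmod (gaf c (of_real (R * s) * cis t))) - ln (max_term (R * s))\<bar> \<partial>lborel) \<partial>lborel)"

text \<open>The deterministic part. At R = 2^J the error in \<open>smoothed_log_bound\<close>
  carries the factor 2^(-Jk), at most 2^(-J) as k >= 1. Thus one hypothesis \<open>lim\<close>, free
  of k, serves all k, and later one null set does too.\<close>

lemma alpha_limit_eq:
  assumes r0: "0 < r0" and cutoff: "cutoff r0 \<phi>" and k: "1 \<le> k"
    and c: "\<And>R::nat. summable (\<lambda>j. cmod (c j) * (real R ^ j / sqrt (fact j)))" "c 0 \<noteq> 0"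
    and lim: "(\<lambda>J. ennreal ((1 / 2) ^ J) * log_deviation r0 c (2 ^ J)) \<longlonglongrightarrow> 0"
  shows "alpha_limit r0 \<phi> k c = fps_nth (neg_log_deriv (gaf_fps c)) (k - 1)"
proof -
  let ?A = "fps_nth (neg_log_deriv (gaf_fps c)) (k - 1)"
  note f = gaf_holomorphic[OF c(1)]
  have f0: "gaf c 0 \<noteq> 0"
    using c(2) by (simp add: gaf_eq_eval_fps eval_fps_at_0 gaf_fps_def)
  note F = gaf_has_fps_expansion[OF c(1)]
  have C: "C_infinity \<phi>"
    using cutoff by (simp add: cutoff_def)
  define D where "D = (\<lambda>t::real. frechet_derivative \<phi> (at (of_real t)) 1)"
  define D2 where "D2 = (\<lambda>t::real. frechet_derivative (\<lambda>x. frechet_derivative \<phi> (at x) 1) (at (of_real t)) 1)"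
  have D: "((\<lambda>t. \<phi> (of_real t)) has_real_derivative D t) (at t)"
    "(D has_real_derivative D2 t) (at t)" for t
    unfolding D_def D2_def by (rule cutoff_has_derivative[OF C] cutoff_has_derivative2[OF C])+
  have contD: "continuous_on S D" for S
    using D(2) by (meson DERIV_isCont continuous_at_imp_continuous_on)
  have contD2: "continuous_on S D2" for S
    unfolding D2_def using cutoff_continuous_derivative2[OF C] by (rule continuous_on_subset) simp
  define g where "g = (\<lambda>s. (s * D2 s - (2 * real k - 1) * D s) / (2 * real k))"
  have contg: "continuous_on {2 * r0..3 * r0} g"
    unfolding g_def using k by (intro continuous_intros contD contD2) auto
  obtain G where G: "\<And>s. s \<in> {2 * r0..3 * r0} \<Longrightarrow> \<bar>g s\<bar> \<le> G"
    using compact_imp_bounded[OF compact_continuous_image[OF contg compact_Icc]]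
    unfolding bounded_iff by (metis image_eqI real_norm_def)
  have kernel: "((\<lambda>s. g s * max 0 (1 - (\<rho> / s) ^ (2 * k))) has_integral radial_cutoff r0 \<phi> \<rho>) {2 * r0..3 * r0}"
    if "0 \<le> \<rho>" for \<rho>
    unfolding g_def radial_cutoff_def
    using r0 k that cutoff_eq_1[OF r0 cutoff] cutoff_eq_0[OF r0 cutoff]
    by (intro smoothing_kernel_has_integral[OF D]) auto
  let ?T = "\<lambda>J. \<Sum>a | cmod a < 3 * r0 * 2 ^ J \<and> gaf c a = 0.
      of_int (zorder (gaf c) a) * (of_real (radial_cutoff r0 \<phi> (cmod a / 2 ^ J)) / a ^ k)"
  have "?T \<longlonglongrightarrow> ?A"
  proof -
    let ?K = "G * k / (pi * (2 * r0) ^ k)"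
    have G0: "0 \<le> G"
      using G[of "2 * r0"] r0 by auto
    have bound: "ennreal (cmod (?T J - ?A)) \<le> ennreal ?K * (ennreal ((1 / 2) ^ J) * log_deviation r0 c (2 ^ J))" for J
    proof -
      have "ennreal (cmod (?T J - ?A)) \<le> ennreal (G * k / (pi * (2 * r0 * 2 ^ J) ^ k)) * log_deviation r0 c (2 ^ J)"
        unfolding log_deviation_def using k r0
        by (intro smoothed_log_bound[where m="\<lambda>r. ln (max_term r)" and g=g] f f0 F contg G kernel)
          (auto simp: radial_cutoff_def)
      also have "\<dots> \<le> ennreal (?K * (1 / 2) ^ J) * log_deviation r0 c (2 ^ J)"
      proof (intro mult_right_mono ennreal_leI)
        have "(2 ^ J :: real) ^ 1 \<le> (2 ^ J) ^ k"
          using k by (intro power_increasing) auto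
        then have "?K / (2 ^ J) ^ k \<le> ?K / 2 ^ J"
          using G0 r0 by (intro divide_left_mono) auto
        then show "G * k / (pi * (2 * r0 * 2 ^ J) ^ k) \<le> ?K * (1 / 2) ^ J"
          by (simp add: power_mult_distrib power_divide field_simps)
      qed simp
      also have "\<dots> = ennreal ?K * (ennreal ((1 / 2) ^ J) * log_deviation r0 c (2 ^ J))"
        unfolding mult.assoc[symmetric] using G0 r0 by (subst ennreal_mult[of ?K, symmetric]) auto
      finally show ?thesis .
    qed
    have "(\<lambda>J. ennreal ?K * (ennreal ((1 / 2) ^ J) * log_deviation r0 c (2 ^ J))) \<longlonglongrightarrow> ennreal ?K * 0"
      by (intro ennreal_tendsto_cmult lim) simp
    then have upper: "(\<lambda>J. ennreal ?K * (ennreal ((1 / 2) ^ J) * log_deviation r0 c (2 ^ J))) \<longlonglongrightarrow> 0"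
      by (simp only: mult_zero_right)
    have "(\<lambda>J. ennreal (cmod (?T J - ?A))) \<longlonglongrightarrow> 0"
      by (rule tendsto_sandwich[OF _ _ tendsto_const upper]) (intro always_eventually allI zero_le bound)+
    then have "(\<lambda>J. ennreal (cmod (?T J - ?A))) \<longlonglongrightarrow> ennreal 0"
      by (simp only: ennreal_0)
    then have "(\<lambda>J. cmod (?T J - ?A)) \<longlonglongrightarrow> 0"
      by (subst (asm) tendsto_ennreal_iff) auto
    then show ?thesis
      by (simp only: tendsto_norm_zero_iff Lim_null[symmetric])
  qed
  then show ?thesis
    unfolding alpha_limit_def by (rule S_outer_eqI[OF r0 cutoff f f0])
qed

context prob_space
begin

context
  fixes \<xi> :: "nat \<Rightarrow> 'a \<Rightarrow> complex" and r0 :: real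
  assumes iid: "iid_std_complex_gaussian M \<xi>" and r0: "0 < r0"
begin

lemma log_deviation_measurable [measurable]:
  "(\<lambda>\<omega>. log_deviation r0 (\<lambda>j. \<xi> j \<omega>) R) \<in> borel_measurable M"
proof -
  note [measurable] = gaussian_measurable[OF iid]
  show ?thesis
    unfolding log_deviation_def by measurable
qed

text \<open>By Tonelli the expectation moves inside, where B bounds it at each point of the annulus;
  the parameter box has sides r0 and 2 \<pi>.\<close>

lemma nn_integral_log_deviation:
  assumes R: "0 < R"
    and B: "\<And>s. s \<in> {2 * r0..3 * r0} \<Longrightarrow>
      (\<integral>\<^sup>+z. ennreal (std_complex_normal_density z) * ennreal (cmod z) \<partial>lborel) +
      ennreal (ln (4 * (R * s)\<^sup>2 + 3)) + ennreal (1 / (1 - exp (-2))) \<le> ennreal B"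
  shows "(\<integral>\<^sup>+\<omega>. log_deviation r0 (\<lambda>j. \<xi> j \<omega>) R \<partial>M) \<le> ennreal B * ennreal (2 * pi * r0)"
proof -
  note [measurable] = gaussian_measurable[OF iid]
  interpret pair_sigma_finite M lborel ..
  define X where "X \<omega> s t = ennreal \<bar>ln (cmod (gaf (\<lambda>j. \<xi> j \<omega>) (of_real (R * s) * cis t))) - ln (max_term (R * s))\<bar>"
    for \<omega> s t
  have "(\<integral>\<^sup>+\<omega>. log_deviation r0 (\<lambda>j. \<xi> j \<omega>) R \<partial>M) =
      (\<integral>\<^sup>+\<omega>. \<integral>\<^sup>+s. (\<integral>\<^sup>+t. X \<omega> s t * indicator {0..2*pi} t \<partial>lborel) * indicator {2 * r0..3 * r0} s \<partial>lborel \<partial>M)"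
    by (simp add: log_deviation_def X_def)
  also have "\<dots> = (\<integral>\<^sup>+s. \<integral>\<^sup>+\<omega>. (\<integral>\<^sup>+t. X \<omega> s t * indicator {0..2*pi} t \<partial>lborel) * indicator {2 * r0..3 * r0} s \<partial>M \<partial>lborel)"
    unfolding X_def by (rule Fubini'[symmetric]) measurable
  also have "\<dots> \<le> (\<integral>\<^sup>+s. ennreal B * ennreal (2 * pi) * indicator {2 * r0..3 * r0} s \<partial>lborel)"
  proof (intro nn_integral_mono)
    fix s
    show "(\<integral>\<^sup>+\<omega>. (\<integral>\<^sup>+t. X \<omega> s t * indicator {0..2*pi} t \<partial>lborel) * indicator {2 * r0..3 * r0} s \<partial>M)
      \<le> ennreal B * ennreal (2 * pi) * indicator {2 * r0..3 * r0} s"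
    proof (cases "s \<in> {2 * r0..3 * r0}")
      case True
      then have s: "0 < R * s"
        using r0 R by auto
      have "(\<integral>\<^sup>+\<omega>. \<integral>\<^sup>+t. X \<omega> s t * indicator {0..2*pi} t \<partial>lborel \<partial>M) =
          (\<integral>\<^sup>+t. \<integral>\<^sup>+\<omega>. X \<omega> s t * indicator {0..2*pi} t \<partial>M \<partial>lborel)"
        unfolding X_def by (rule Fubini'[symmetric]) measurable
      also have "\<dots> = (\<integral>\<^sup>+t. (\<integral>\<^sup>+\<omega>. X \<omega> s t \<partial>M) * indicator {0..2*pi} t \<partial>lborel)"
        unfolding X_def by (intro nn_integral_cong nn_integral_multc) measurable
      also have "\<dots> \<le> (\<integral>\<^sup>+t. ennreal B * indicator {0..2*pi} t \<partial>lborel)"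
      proof (intro nn_integral_mono mult_right_mono)
        fix t
        have cm: "cmod (of_real (R * s) * cis t) = R * s"
          using s by (simp only: norm_mult norm_of_real norm_cis mult_1_right abs_of_pos)
        have "of_real (R * s) * cis t \<noteq> 0"
          using s by auto
        from nn_integral_log_gaf[OF iid this] show "(\<integral>\<^sup>+\<omega>. X \<omega> s t \<partial>M) \<le> ennreal B"
          unfolding X_def cm using B[OF True] by (rule order_trans)
      qed simp
      also have "\<dots> = ennreal B * ennreal (2 * pi)"
        by (simp add: nn_integral_cmult)
      finally show ?thesis
        using True by simp
    qed simp
  qed
  also have "\<dots> = ennreal B * ennreal (2 * pi * r0)"
    using r0 by (simp add: nn_integral_cmult ennreal_mult mult.assoc)
  finally show ?thesis .
qed

text \<open>The pointwise bound is logarithmic in the radius, hence linear in J along dyadic radii,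
  a growth that the factor 2^(-J) beats.\<close>

lemma nn_integral_log_deviation_dyadic:
  "\<exists>C::real. 0 \<le> C \<and>
    (\<forall>J. (\<integral>\<^sup>+\<omega>. log_deviation r0 (\<lambda>j. \<xi> j \<omega>) (2 ^ J) \<partial>M) \<le> ennreal (C * Suc J))"
proof -
  obtain e where e: "0 \<le> e" "(\<integral>\<^sup>+z. ennreal (std_complex_normal_density z) * ennreal (cmod z) \<partial>lborel) = ennreal e"
    using nn_integral_normal_cmod by (cases "\<integral>\<^sup>+z. ennreal (std_complex_normal_density z) * ennreal (cmod z) \<partial>lborel") auto
  \<comment> \<open>The summand 3 absorbs the growth in J: J ln 4 <= 3 J, and b + 3 J <= b (J + 1)
    since b >= 3.\<close>
  define b where "b = e + 1 / (1 - exp (-2)) + ln (36 * r0\<^sup>2 + 3) + 3"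
  have pos: "0 \<le> 1 / (1 - exp (-2 :: real))" "0 \<le> ln (36 * r0\<^sup>2 + 3)"
    by (auto simp: add_increasing)
  then have b3: "3 \<le> b"
    using e(1) by (simp add: b_def)
  then have b: "0 \<le> b"
    by simp
  have "(\<integral>\<^sup>+\<omega>. log_deviation r0 (\<lambda>j. \<xi> j \<omega>) (2 ^ J) \<partial>M) \<le> ennreal (b * Suc J) * ennreal (2 * pi * r0)" for J
  proof (rule nn_integral_log_deviation)
    fix s assume s: "s \<in> {2 * r0..3 * r0}"
    have "s\<^sup>2 \<le> (3 * r0)\<^sup>2"
      using s r0 by (intro power_mono) auto
    then have "4 ^ J * s\<^sup>2 \<le> 9 * (4 ^ J * r0\<^sup>2)"
      by simp
    moreover have "(1::real) \<le> 4 ^ J"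
      by simp
    moreover have "(2 ^ J * s)\<^sup>2 = 4 ^ J * s\<^sup>2"
      by (simp add: power_mult_distrib power_mult[symmetric] mult.commute[of J]) (simp add: power_mult)
    ultimately have "4 * (2 ^ J * s)\<^sup>2 + 3 \<le> 36 * (4 ^ J * r0\<^sup>2) + 3 * 4 ^ J"
      by linarith
    then have "4 * (2 ^ J * s)\<^sup>2 + 3 \<le> (36 * r0\<^sup>2 + 3) * 4 ^ J"
      by (simp add: algebra_simps)
    then have "ln (4 * (2 ^ J * s)\<^sup>2 + 3) \<le> ln ((36 * r0\<^sup>2 + 3) * 4 ^ J)"
      by (subst ln_le_cancel_iff) (auto simp: add_nonneg_pos)
    also have "\<dots> = ln (36 * r0\<^sup>2 + 3) + J * ln 4"
    proof -
      have "0 < 36 * r0\<^sup>2 + 3"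
        by (simp add: add_nonneg_pos)
      then show ?thesis
        by (simp add: ln_mult ln_realpow)
    qed
    also have "\<dots> \<le> ln (36 * r0\<^sup>2 + 3) + J * 3"
      using ln_le_minus_one[of "4 :: real"] mult_left_mono[of "ln 4" 3 "real J"] by simp
    finally have "e + ln (4 * (2 ^ J * s)\<^sup>2 + 3) + 1 / (1 - exp (-2)) \<le> b + 3 * J"
      by (simp add: b_def)
    also have "\<dots> \<le> b * Suc J"
      using mult_right_mono[of 3 b "real J"] b3 by (simp add: algebra_simps)
    finally have "ennreal (e + ln (4 * (2 ^ J * s)\<^sup>2 + 3) + 1 / (1 - exp (-2))) \<le> ennreal (b * Suc J)"
      by (rule ennreal_leI)
    moreover have "0 \<le> ln (4 * (2 ^ J * s)\<^sup>2 + 3)"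
      by (auto simp: add_increasing)
    ultimately show "(\<integral>\<^sup>+z. ennreal (std_complex_normal_density z) * ennreal (cmod z) \<partial>lborel) +
      ennreal (ln (4 * (2 ^ J * s)\<^sup>2 + 3)) + ennreal (1 / (1 - exp (-2))) \<le> ennreal (b * Suc J)"
      unfolding e(2) using e(1) pos by (simp add: ennreal_plus[symmetric] del: ennreal_plus)
  qed simp
  moreover have "ennreal (b * Suc J) * ennreal (2 * pi * r0) = ennreal (b * (2 * pi * r0) * Suc J)" for J
    using b r0 by (subst ennreal_mult[symmetric]) (auto simp: mult_ac)
  ultimately show ?thesis
    using b r0 by (intro exI[of _ "b * (2 * pi * r0)"]) auto
qed

text \<open>The expectations are summable over J, so the series itself is almost surely finite and
  its terms tend to 0.\<close>

lemma AE_log_deviation_tendsto: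
  "AE \<omega> in M. (\<lambda>J. ennreal ((1 / 2) ^ J) * log_deviation r0 (\<lambda>j. \<xi> j \<omega>) (2 ^ J)) \<longlonglongrightarrow> 0"
proof -
  let ?X = "\<lambda>\<omega> J. ennreal ((1 / 2) ^ J) * log_deviation r0 (\<lambda>j. \<xi> j \<omega>) (2 ^ J)"
  obtain C :: real where C: "0 \<le> C"
    "\<And>J. (\<integral>\<^sup>+\<omega>. log_deviation r0 (\<lambda>j. \<xi> j \<omega>) (2 ^ J) \<partial>M) \<le> ennreal (C * Suc J)"
    using nn_integral_log_deviation_dyadic by blast
  have summable: "summable (\<lambda>J. C * (real (Suc J) * (1 / 2) ^ J))"
    using geometric_deriv_sums[of "1 / 2 :: real"] by (intro summable_mult) (auto simp: sums_iff)
  have "(\<integral>\<^sup>+\<omega>. (\<Sum>J. ?X \<omega> J) \<partial>M) = (\<Sum>J. \<integral>\<^sup>+\<omega>. ?X \<omega> J \<partial>M)"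
    by (rule nn_integral_suminf) measurable
  also have "\<dots> \<le> (\<Sum>J. ennreal (C * (real (Suc J) * (1 / 2) ^ J)))"
  proof (intro suminf_le allI)
    fix J
    have "(\<integral>\<^sup>+\<omega>. ?X \<omega> J \<partial>M) \<le> ennreal ((1 / 2) ^ J) * ennreal (C * Suc J)"
      by (subst nn_integral_cmult) (measurable, intro mult_left_mono C(2), simp)
    also have "\<dots> = ennreal (C * (real (Suc J) * (1 / 2) ^ J))"
      using C(1) by (subst ennreal_mult[symmetric]) (auto simp: mult_ac)
    finally show "(\<integral>\<^sup>+\<omega>. ?X \<omega> J \<partial>M) \<le> \<dots>" .
  qed auto
  also have "\<dots> = ennreal (\<Sum>J. C * (real (Suc J) * (1 / 2) ^ J))"
    using C(1) by (intro suminf_ennreal2 summable) auto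
  finally have "(\<integral>\<^sup>+\<omega>. (\<Sum>J. ?X \<omega> J) \<partial>M) \<noteq> \<infinity>"
    by (auto simp: top_unique)
  then have "AE \<omega> in M. (\<Sum>J. ?X \<omega> J) \<noteq> \<infinity>"
    by (rule nn_integral_noteq_infinite[rotated]) measurable
  then show ?thesis
  proof eventually_elim
    case (elim \<omega>)
    have finite: "?X \<omega> J \<noteq> \<infinity>" for J
      using elim sum_le_suminf[of "?X \<omega>" "{J}"] by (auto simp: top_unique)
    then have eq: "?X \<omega> J = ennreal (enn2real (?X \<omega> J))" for J
      by (simp add: less_top)
    then have "(\<Sum>J. ennreal (enn2real (?X \<omega> J))) \<noteq> \<infinity>"
      using elim by simp
    then have "summable (\<lambda>J. enn2real (?X \<omega> J))"
      by (intro summable_suminf_not_top) auto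
    then have "(\<lambda>J. ennreal (enn2real (?X \<omega> J))) \<longlonglongrightarrow> ennreal 0"
      by (intro tendsto_ennrealI summable_LIMSEQ_zero)
    then show ?case
      using eq by simp
  qed
qed

lemma AE_alpha_limit_eq:
  assumes cutoff: "cutoff r0 \<phi>"
  shows "AE \<omega> in M. \<forall>k\<ge>1. alpha_limit r0 \<phi> k (\<lambda>j. \<xi> j \<omega>) = fps_nth (neg_log_deriv (gaf_fps (\<lambda>j. \<xi> j \<omega>))) (k - 1)"
  using gaussian_AE_nonzero[OF iid, of 0] gaussian_AE_summable[OF iid] AE_log_deviation_tendsto
  by eventually_elim (intro allI impI alpha_limit_eq[OF r0 cutoff], auto)

end

end

section \<open>Measurability on the completion, and the conclusion\<close>

lemma measurable_completion_AE_eq: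
  assumes g: "g \<in> M \<rightarrow>\<^sub>M N" and ae: "AE x in M. f x = g x" and space: "\<And>x. x \<in> space M \<Longrightarrow> f x \<in> space N"
  shows "f \<in> completion M \<rightarrow>\<^sub>M N"
proof (rule measurableI)
  fix A assume A: "A \<in> sets N"
  show "f -` A \<inter> space (completion M) \<in> sets (completion M)"
  proof (rule completion.in_sets_AE)
    show "g -` A \<inter> space M \<in> sets (completion M)"
      using g A by auto
    show "AE x in completion M. x \<in> g -` A \<inter> space M \<longleftrightarrow> x \<in> f -` A \<inter> space (completion M)"
      using AE_completion[OF ae] by eventually_elim simp
  qed simp
qed (use space in simp)

text \<open>Sums over random zeros become measurable through their almost sure value, a coefficient
  of -F'/F, which is a rational function of finitely many coefficients of F. The completion ignores
  the exceptional set.\<close>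

lemma measurable_completion_neg_log_deriv_gaf:
  fixes d :: "'w \<Rightarrow> nat \<Rightarrow> complex"
  assumes [measurable]: "\<And>j. (\<lambda>\<omega>. d \<omega> j) \<in> borel_measurable M"
    and ae: "AE \<omega> in M. d \<omega> 0 \<noteq> 0" "AE \<omega> in M. f \<omega> = fps_nth (neg_log_deriv (gaf_fps (d \<omega>))) m"
  shows "f \<in> borel_measurable (completion M)"
proof (rule measurable_completion_AE_eq)
  \<comment> \<open>Where coefficient 0 vanishes, a null event, the sequence is replaced by ones,
    which keeps the series invertible everywhere.\<close>
  let ?d = "\<lambda>\<omega>. if d \<omega> 0 = 0 then (\<lambda>_. 1) else d \<omega>"
  show "(\<lambda>\<omega>. fps_nth (neg_log_deriv (gaf_fps (?d \<omega>))) m) \<in> borel_measurable M"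
  proof (rule measurable_neg_log_deriv_nth)
    fix i
    have "(\<lambda>\<omega>. (if d \<omega> 0 = 0 then 1 else d \<omega> i) / of_real (sqrt (fact i))) \<in> borel_measurable M"
      by measurable
    then show "(\<lambda>\<omega>. fps_nth (gaf_fps (?d \<omega>)) i) \<in> borel_measurable M"
      by (simp add: gaf_fps_def if_distrib[of "\<lambda>c. c i"] cong: if_cong)
  qed (simp add: gaf_fps_def)
  show "AE \<omega> in M. f \<omega> = fps_nth (neg_log_deriv (gaf_fps (?d \<omega>))) m"
    using ae by eventually_elim simp
qed simp

theorem proposition10p16:
  fixes M :: "'w measure" and \<xi> :: "nat \<Rightarrow> 'w \<Rightarrow> complex"
    and r0 :: real and \<phi> :: "complex \<Rightarrow> real"
  assumes "prob_space M"
    and "iid_std_complex_gaussian M \<xi>"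
    and "r0 > 0"
    and "cutoff r0 \<phi>"
  shows "(\<forall>k\<ge>1. tendsto_in_probability (completion M)
              (\<lambda>n \<omega>. alpha_trunc r0 k n (\<lambda>j. \<xi> j \<omega>))
              (\<lambda>\<omega>. alpha_limit r0 \<phi> k (\<lambda>j. \<xi> j \<omega>))) \<and>
         (\<exists>s :: nat \<Rightarrow> nat. strict_mono s \<and>
            (AE \<omega> in M. \<forall>k\<ge>1.
               (\<lambda>n. alpha_trunc r0 k (s n) (\<lambda>j. \<xi> j \<omega>))
                 \<longlonglongrightarrow> alpha_limit r0 \<phi> k (\<lambda>j. \<xi> j \<omega>)))"
proof -
  interpret prob_space M by fact
  note [measurable] = gaussian_measurable[OF assms(2)]
  have nz: "AE \<omega> in M. \<xi> 0 \<omega> \<noteq> 0"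
    by (rule gaussian_AE_nonzero[OF assms(2)])
  note limit = AE_alpha_limit_eq[OF assms(2-4)]
  \<comment> \<open>One null set outside of which both sides agree for all k and all n >= k. Both
    modes of convergence follow, as the sequence is eventually constant.\<close>
  have eq: "AE \<omega> in M. \<forall>k\<ge>1. \<forall>n\<ge>k. alpha_trunc r0 k n (\<lambda>j. \<xi> j \<omega>) = alpha_limit r0 \<phi> k (\<lambda>j. \<xi> j \<omega>)"
    using nz limit by eventually_elim (simp add: alpha_trunc_eventually_const)
  have "tendsto_in_probability (completion M) (\<lambda>n \<omega>. alpha_trunc r0 k n (\<lambda>j. \<xi> j \<omega>))
      (\<lambda>\<omega>. alpha_limit r0 \<phi> k (\<lambda>j. \<xi> j \<omega>))" if k: "1 \<le> k" for k
    unfolding tendsto_in_probability_def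
  proof (intro conjI allI impI)
    fix n
    show "(\<lambda>\<omega>. alpha_trunc r0 k n (\<lambda>j. \<xi> j \<omega>)) \<in> borel_measurable (completion M)"
    proof (rule measurable_completion_neg_log_deriv_gaf)
      show "AE \<omega> in M. alpha_trunc r0 k n (\<lambda>j. \<xi> j \<omega>) =
          fps_nth (neg_log_deriv (gaf_fps (\<lambda>j. if j \<le> n then \<xi> j \<omega> else 0))) (k - 1)"
        using nz by eventually_elim (rule alpha_trunc_eq[OF _ k])
    qed (use nz in simp_all)
  next
    show "(\<lambda>\<omega>. alpha_limit r0 \<phi> k (\<lambda>j. \<xi> j \<omega>)) \<in> borel_measurable (completion M)"
      using nz limit k by (intro measurable_completion_neg_log_deriv_gaf[where d="\<lambda>\<omega> j. \<xi> j \<omega>"]) auto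
  next
    fix \<epsilon> :: real assume "0 < \<epsilon>"
    have "measure (completion M) {\<omega> \<in> space (completion M).
        \<epsilon> < dist (alpha_trunc r0 k n (\<lambda>j. \<xi> j \<omega>)) (alpha_limit r0 \<phi> k (\<lambda>j. \<xi> j \<omega>))} = 0" if "k \<le> n" for n
    proof -
      have "AE \<omega> in completion M.
          \<not> \<epsilon> < dist (alpha_trunc r0 k n (\<lambda>j. \<xi> j \<omega>)) (alpha_limit r0 \<phi> k (\<lambda>j. \<xi> j \<omega>))"
        using AE_completion[OF eq] by eventually_elim (use k that \<open>0 < \<epsilon>\<close> in simp)
      then show ?thesis
        unfolding completion.AE_iff_null_sets by (intro measure_eq_0_null_sets) simp
    qed
    then show "(\<lambda>n. measure (completion M) {\<omega> \<in> space (completion M).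
        \<epsilon> < dist (alpha_trunc r0 k n (\<lambda>j. \<xi> j \<omega>)) (alpha_limit r0 \<phi> k (\<lambda>j. \<xi> j \<omega>))}) \<longlonglongrightarrow> 0"
      by (intro tendsto_eventually eventually_sequentiallyI[of k])
  qed
  moreover have "AE \<omega> in M. \<forall>k\<ge>1. (\<lambda>n. alpha_trunc r0 k n (\<lambda>j. \<xi> j \<omega>)) \<longlonglongrightarrow> alpha_limit r0 \<phi> k (\<lambda>j. \<xi> j \<omega>)"
    using eq
  proof eventually_elim
    case (elim \<omega>)
    show ?case
    proof (intro allI impI tendsto_eventually)
      fix k :: nat assume "1 \<le> k"
      with elim show "\<forall>\<^sub>F n in sequentially. alpha_trunc r0 k n (\<lambda>j. \<xi> j \<omega>) = alpha_limit r0 \<phi> k (\<lambda>j. \<xi> j \<omega>)"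
        by (intro eventually_sequentiallyI[of k]) blast
    qed
  qed
  \<comment> \<open>The full sequence already converges almost surely, so the identity serves as the
    subsequence.\<close>
  ultimately show ?thesis
    by (intro conjI exI[of _ "\<lambda>n. n"]) (auto simp: strict_mono_def)
qed

end
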